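(* Let $\Omega=(0,1)$ and let $k$, $\mathcal A$ be as in the context. Then there are constants $c,C>0$ such that for all $s>1$ $$\frac{c}{\operatorname{Re}\hat k(is)}\le\sup_{1\le|\sigma|\le s}\|(i\sigma+\mathcal A)^{-1}\|_{\mathcal H\to\mathcal H}\le\frac{C}{\operatorname{Re}\hat k(is)} .$$
   Context: $\Omega=(0,1)$, with boundary $\partial\Omega=\{0,1\}$ carrying counting measure $dS$; the outward normal $n$ is $-1$ at $0$ and $+1$ at $1$; $\Gamma:H^1(0,1)\to L^2(\partial\Omega)\cong\mathbb C^2$ is evaluation at the endpoints. All function spaces are complex. $k:(0,\infty)\to[0,\infty)$ is an integrable, completely monotonic function, not identically zero, i.e. $k(t)=\int_{[0,\infty)}e^{-\tau t}\,d\nu(\tau)$ with a positive Radon measure $\nu$ on $[0,\infty)$; integrability means $\nu(\{0\})=0$ and $\int_0^\infty\tau^{-1}d\nu(\tau)<\infty$. For $z\in\mathbb C\setminus(-\infty,0)$ put $\hat k(z)=\int_0^\infty\frac{d\nu(\tau)}{z+\tau}$. Write $L^2_\nu=L^2_\nu((0,\infty)_\tau;L^2(\partial\Omega))$. The energy space is $\mathcal H=L^2(\Omega)\times\nabla H^1(\Omega)\times L^2_\nu$ (here $\nabla H^1(\Omega)=\{U':U\in H^1(0,1)\}=L^2(0,1)$), with norm $\|(p,v,\psi)\|_{\mathcal H}^2=\int_\Omega(|p|^2+|v|^2)dx+\int_0^\infty\int_{\partial\Omega}|\psi(\tau,x)|^2dS\,d\nu(\tau)$. The wave operator is $\mathcal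 A(p,v,\psi)=(v',\ p',\ \tau\psi-\Gamma p)$ with domain $D(\mathcal A)$ consisting of all $(p,v,\psi)\in\mathcal H$ with $p,v\in H^1(0,1)$, $\tau\psi-\Gamma p\in L^2_\nu$ and $-v\cdot n+\int_0^\infty\psi(\tau)\,d\nu(\tau)=0$ on $\partial\Omega$ (the integral converges since then $\psi\in L^1_\nu$). It is known that $i\sigma+\mathcal A$ is boundedly invertible for every real $\sigma\ne0$. *)

theory Defs
  imports "HOL-Analysis.Analysis"
begin

text \<open>
  Elements of $L^2$ spaces are represented by functions. Equality of elements is equality almost
  everywhere, and the norm of the energy space is a seminorm on representatives.
\<close>

definition L2 :: "'a measure \<Rightarrow> ('a \<Rightarrow> complex) set" where
  "L2 M = {f. f \<in> borel_measurable M \<and> integrable M (\<lambda>x. (cmod (f x))\<^sup>2)}"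

abbreviation Omega :: "real measure" where
  "Omega \<equiv> restrict_space lborel {0<..<1}"

definition test_function :: "(real \<Rightarrow> real) \<Rightarrow> bool" where
  "test_function \<phi> \<longleftrightarrow>
     (\<forall>n x. (deriv ^^ n) \<phi> field_differentiable (at x)) \<and>
     (\<exists>a b. 0 < a \<and> a < b \<and> b < 1 \<and> (\<forall>x. x \<notin> {a..b} \<longrightarrow> \<phi> x = 0))"

definition weak_derivative :: "(real \<Rightarrow> complex) \<Rightarrow> (real \<Rightarrow> complex) \<Rightarrow> bool" where
  "weak_derivative u g \<longleftrightarrow>
     (\<forall>\<phi>. test_function \<phi> \<longrightarrow>
        (LINT x|Omega. u x * complex_of_real (deriv \<phi> x)) =
        - (LINT x|Omega. g x * complex_of_real (\<phi> x)))"

definition H1 :: "(real \<Rightarrow> complex) set" where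
  "H1 = {u \<in> L2 Omega. \<exists>g \<in> L2 Omega. weak_derivative u g}"

definition wderiv :: "(real \<Rightarrow> complex) \<Rightarrow> real \<Rightarrow> complex" where
  "wderiv u = (SOME g. g \<in> L2 Omega \<and> weak_derivative u g)"

definition grad_H1 :: "(real \<Rightarrow> complex) set" where
  "grad_H1 = {v \<in> L2 Omega. \<exists>U \<in> H1. weak_derivative U v}"

text \<open>The boundary consists of the points 0 and 1; functions on it are only looked at there.\<close>

abbreviation boundary :: "real set" where
  "boundary \<equiv> {0, 1}"

definition outer_normal :: "real \<Rightarrow> real" where
  "outer_normal x = (if x = 0 then - 1 else 1)"

text \<open>The trace evaluates the continuous representative, which is unique on $[0,1]$.\<close>

definition boundary_trace :: "(real \<Rightarrow> complex) \<Rightarrow> real \<Rightarrow> complex" where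
  "boundary_trace u x = (THE y. \<exists>w. continuous_on {0..1} w \<and> (AE t in Omega. w t = u t) \<and> y = w x)"

text \<open>
  The measure \<open>\<nu>\<close> below is a Borel measure on the line that does not charge the negative numbers.
  For an integrable kernel it does not charge 0 either, so that integrals over $(0,\infty)$ are
  integrals with respect to \<open>\<nu>\<close>.
\<close>

definition khat :: "real measure \<Rightarrow> complex \<Rightarrow> complex" where
  "khat \<nu> z = (LINT \<tau>|\<nu>. 1 / (z + complex_of_real \<tau>))"

definition L2_boundary :: "real measure \<Rightarrow> (real \<Rightarrow> real \<Rightarrow> complex) set" where
  "L2_boundary \<nu> = {\<psi>. \<forall>x \<in> boundary. (\<lambda>\<tau>. \<psi> \<tau> x) \<in> L2 \<nu>}"

type_synonym state =
  "(real \<Rightarrow> complex) \<times> (real \<Rightarrow> complex) \<times> (real \<Rightarrow> real \<Rightarrow> complex)"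

definition energy_space :: "real measure \<Rightarrow> state set" where
  "energy_space \<nu> = L2 Omega \<times> grad_H1 \<times> L2_boundary \<nu>"

fun energy_norm :: "real measure \<Rightarrow> state \<Rightarrow> real" where
  "energy_norm \<nu> (p, v, \<psi>) =
     sqrt ((LINT x|Omega. ((cmod (p x))\<^sup>2 + (cmod (v x))\<^sup>2)) +
           (LINT \<tau>|\<nu>. (\<Sum>x\<in>boundary. (cmod (\<psi> \<tau> x))\<^sup>2)))"

fun state_eq :: "real measure \<Rightarrow> state \<Rightarrow> state \<Rightarrow> bool" where
  "state_eq \<nu> (p, v, \<psi>) (q, w, \<eta>) \<longleftrightarrow>
     (AE x in Omega. p x = q x) \<and> (AE x in Omega. v x = w x) \<and>
     (AE \<tau> in \<nu>. \<forall>x \<in> boundary. \<psi> \<tau> x = \<eta> \<tau> x)"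

definition wave_domain :: "real measure \<Rightarrow> state set" where
  "wave_domain \<nu> = {(p, v, \<psi>) \<in> energy_space \<nu>.
     p \<in> H1 \<and> v \<in> H1 \<and>
     (\<lambda>\<tau> x. complex_of_real \<tau> * \<psi> \<tau> x - boundary_trace p x) \<in> L2_boundary \<nu> \<and>
     (\<forall>x \<in> boundary.
        - boundary_trace v x * complex_of_real (outer_normal x) + (LINT \<tau>|\<nu>. \<psi> \<tau> x) = 0)}"

fun wave_op :: "state \<Rightarrow> state" where
  "wave_op (p, v, \<psi>) =
     (wderiv v, wderiv p, \<lambda>\<tau> x. complex_of_real \<tau> * \<psi> \<tau> x - boundary_trace p x)"

fun state_add :: "state \<Rightarrow> state \<Rightarrow> state" where
  "state_add (p, v, \<psi>) (q, w, \<eta>) =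
     (\<lambda>x. p x + q x, \<lambda>x. v x + w x, \<lambda>\<tau> x. \<psi> \<tau> x + \<eta> \<tau> x)"

fun state_scale :: "complex \<Rightarrow> state \<Rightarrow> state" where
  "state_scale c (p, v, \<psi>) = (\<lambda>x. c * p x, \<lambda>x. c * v x, \<lambda>\<tau> x. c * \<psi> \<tau> x)"

definition shifted_wave_op :: "real \<Rightarrow> state \<Rightarrow> state" where
  "shifted_wave_op \<sigma> U = state_add (state_scale (\<i> * complex_of_real \<sigma>) U) (wave_op U)"

text \<open>
  \<open>inverse_bound \<nu> \<sigma> C\<close>: the shifted operator maps its domain onto the energy space and its inverse
  is bounded by \<open>C\<close>. Taking \<open>F = 0\<close>, the estimate contains injectivity up to null sets.
\<close>

definition inverse_bound :: "real measure \<Rightarrow> real \<Rightarrow> real \<Rightarrow> bool" where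
  "inverse_bound \<nu> \<sigma> C \<longleftrightarrow> 0 \<le> C \<and>
     (\<forall>F \<in> energy_space \<nu>.
        (\<exists>U \<in> wave_domain \<nu>. state_eq \<nu> (shifted_wave_op \<sigma> U) F) \<and>
        (\<forall>U \<in> wave_domain \<nu>. state_eq \<nu> (shifted_wave_op \<sigma> U) F \<longrightarrow>
           energy_norm \<nu> U \<le> C * energy_norm \<nu> F))"

text \<open>Operator norm of the inverse; its value is \<open>\<infinity>\<close> if there is no bounded inverse.\<close>

definition resolvent_norm :: "real measure \<Rightarrow> real \<Rightarrow> ereal" where
  "resolvent_norm \<nu> \<sigma> = (INF C \<in> {C. inverse_bound \<nu> \<sigma> C}. ereal C)"

end

theory Submission
  imports Defs
begin

text \<open>
  With \<open>a = p + v\<close> and \<open>b = p - v\<close> the resolvent equation \<open>(i\<sigma> + A)(p, v, \<psi>) = (f, g, h)\<close> decouples into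
  the transport equations \<open>a' = -i\<sigma> a + (f + g)\<close> and \<open>b' = i\<sigma> b + (g - f)\<close>. Its third component gives
  \<open>\<psi> = (p + h) / (i\<sigma> + \<tau>)\<close> at the end points, so the boundary condition becomes an impedance condition
  \<open>v n = \<kappa> p + H\<close> with \<open>\<kappa> = khat (i\<sigma>)\<close> and \<open>H = \<integral> h / (i\<sigma> + \<tau>) d\<nu>\<close>. What remains is a linear \<open>2 \<times> 2\<close>
  system for \<open>a 0\<close> and \<open>b 0\<close> with determinant \<open>D = (1 - \<kappa>)\<^sup>2 exp (-i\<sigma>) - (1 + \<kappa>)\<^sup>2 exp (i\<sigma>)\<close>, and
  \<open>\<bar>D\<bar> \<ge> \<bar>1 + \<kappa>\<bar>\<^sup>2 - \<bar>1 - \<kappa>\<bar>\<^sup>2 = 4 Re \<kappa>\<close>: each reflection dissipates a share of the energy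
  that is comparable to \<open>Re \<kappa>\<close>.

  Upper bound: as \<open>\<bar>\<kappa>\<bar>\<close> is bounded by \<open>K = \<integral> \<tau>\<^sup>-\<^sup>1 d\<nu>\<close>, Cramer's rule bounds the resolvent by a constant over
  \<open>Re \<kappa>\<close> (\<open>resolvent_norm_le\<close>), and \<open>Re \<kappa> = \<integral> \<tau> / (\<sigma>\<^sup>2 + \<tau>\<^sup>2) d\<nu>\<close> decreases in \<open>\<bar>\<sigma>\<bar>\<close>.

  Lower bound: if \<open>exp w = (1 + \<kappa>) / (1 - \<kappa>)\<close>, then \<open>p = cosh (w (x - 1/2))\<close> and \<open>v = sinh (w (x - 1/2))\<close>
  satisfy the boundary condition exactly, and \<open>i\<sigma> + A\<close> multiplies \<open>(p, v)\<close> by \<open>i\<sigma> + w\<close>; hence the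
  resolvent norm is at least \<open>1 / \<bar>i\<sigma> + w\<bar>\<close> (\<open>resolvent_norm_ge\<close>). Since \<open>\<kappa>\<close> tends to 0, the reflection
  coefficient \<open>(1 - \<kappa>) / (1 + \<kappa>)\<close> tends to 1, and by the intermediate value theorem at high frequencies every long
  interval contains a resonant \<open>\<sigma>\<close> at which the phase shift of a crossing and a reflection is a multiple of \<open>2\<pi>\<close>. There
  \<open>w = -i\<sigma> + \<lambda>\<close> with real \<open>\<lambda> \<le> 4 Re \<kappa>\<close>. A resonance between \<open>s/2\<close> and \<open>s\<close> suffices, because halving the
  frequency changes \<open>Re \<kappa>\<close> by a factor of at most 4.

  The weak formulation enters through one fact: a weak solution of \<open>u' = \<mu> u + G\<close> agrees almost
  everywhere with a Duhamel formula (\<open>weak_ODE_solution\<close>). It rests on the lemma of du Bois-Reymond,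
  whose proof needs explicit smooth functions with compact support.
\<close>

section \<open>Smooth functions with compact support\<close>

text \<open>The functions \<open>x\<^sup>-\<^sup>m exp (-1/x)\<close>, extended by 0, are carried along together because differentiation
  produces negative powers of \<open>x\<close>.\<close>

definition flat :: "nat \<Rightarrow> real \<Rightarrow> real" where
  "flat m x = (if 0 < x then exp (- (1 / x)) / x ^ m else 0)"

text \<open>The case of exponent \<open>m + 1\<close> says that the difference quotient of \<open>flat m\<close> at 0 vanishes in the limit.\<close>

lemma flat_tendsto_0: "(flat m \<longlongrightarrow> 0) (at 0)"
proof -
  have "((\<lambda>x. inverse x ^ m / exp (inverse x)) \<longlongrightarrow> (0::real)) (at_right 0)"
    by (rule filterlim_compose[OF tendsto_power_div_exp_0 filterlim_inverse_at_top_right])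
  then have "(flat m \<longlongrightarrow> 0) (at_right 0)"
    by (rule Lim_transform_eventually)
       (auto simp: flat_def eventually_at_filter exp_minus field_simps power_divide)
  moreover have "(flat m \<longlongrightarrow> 0) (at_left 0)"
    by (rule tendsto_eventually) (auto simp: flat_def eventually_at_filter)
  ultimately show ?thesis
    by (simp add: filterlim_split_at)
qed

lemma DERIV_flat: "(flat m has_real_derivative flat (m + 2) x - m * flat (m + 1) x) (at x)"
proof -
  consider "x < 0" | "x = 0" | "0 < x" by linarith
  then show ?thesis
  proof cases
    case 1
    have "((\<lambda>_. 0) has_real_derivative 0) (at x)" by simp
    moreover have "\<forall>\<^sub>F y in nhds x. flat m y = 0"
      using eventually_nhds_in_open[of "{..<0}" x] 1 by (auto elim!: eventually_mono simp: flat_def)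
    ultimately show ?thesis
      using 1 by (subst DERIV_cong_ev[OF refl _ refl, where g = "\<lambda>_. 0"]) (auto simp: flat_def)
  next
    case 2
    have "(\<lambda>h. (flat m (0 + h) - flat m 0) / h) = flat (Suc m)"
      by (auto simp: flat_def fun_eq_iff)
    then show ?thesis
      using flat_tendsto_0[of "Suc m"] 2 by (simp add: DERIV_def) (simp add: flat_def)
  next
    case 3
    have "((\<lambda>y. exp (- (1 / y)) / y ^ m) has_real_derivative
        flat (m + 2) x - m * flat (m + 1) x) (at x)"
    proof (cases m)
      case 0
      then show ?thesis using 3
        by (auto intro!: derivative_eq_intros simp: flat_def power2_eq_square divide_simps)
    next
      case (Suc j)
      then show ?thesis using 3
        by (auto intro!: derivative_eq_intros simp: flat_def divide_simps power_add)
           (simp add: algebra_simps power2_eq_square, cases j, auto)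
    qed
    moreover have "\<forall>\<^sub>F y in nhds x. flat m y = exp (- (1 / y)) / y ^ m"
      using eventually_nhds_in_open[of "{0<..}" x] 3 by (auto elim!: eventually_mono simp: flat_def)
    ultimately show ?thesis
      by (subst DERIV_cong_ev[OF refl _ refl, where g = "\<lambda>y. exp (- (1 / y)) / y ^ m"]) auto
  qed
qed

text \<open>Smoothness in terms of iterated \<open>deriv\<close> is awkward for products. Instead, this class of functions is closed
  under differentiation by construction, so that all its members are smooth.\<close>

inductive_set flat_algebra :: "(real \<Rightarrow> real) set" where
  flat: "(\<lambda>x. flat m (c * x + d)) \<in> flat_algebra"
| const: "(\<lambda>x. c) \<in> flat_algebra"
| add: "f \<in> flat_algebra \<Longrightarrow> g \<in> flat_algebra \<Longrightarrow> (\<lambda>x. f x + g x) \<in> flat_algebra"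
| mult: "f \<in> flat_algebra \<Longrightarrow> g \<in> flat_algebra \<Longrightarrow> (\<lambda>x. f x * g x) \<in> flat_algebra"

lemma flat_algebra_DERIV:
  assumes "f \<in> flat_algebra"
  shows "\<exists>g \<in> flat_algebra. \<forall>x. (f has_real_derivative g x) (at x)"
  using assms
proof induction
  case (flat m c d)
  let ?g = "\<lambda>x. c * (flat (m + 2) (c * x + d) + (- real m) * flat (m + 1) (c * x + d))"
  have "?g \<in> flat_algebra" by (intro flat_algebra.intros)
  moreover have "((\<lambda>x. flat m (c * x + d)) has_real_derivative ?g x) (at x)" for x
    by (rule DERIV_cong[OF DERIV_chain2[OF DERIV_flat]])
       (auto intro!: derivative_eq_intros)
  ultimately show ?case
    by (intro bexI[of _ ?g]) auto
next
  case (const c)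
  show ?case by (intro bexI[of _ "\<lambda>_. 0"] flat_algebra.const) auto
next
  case (add f g)
  then obtain f' g' where "f' \<in> flat_algebra" "g' \<in> flat_algebra"
    "\<And>x. (f has_real_derivative f' x) (at x)" "\<And>x. (g has_real_derivative g' x) (at x)"
    by blast
  then show ?case
    by (intro bexI[of _ "\<lambda>x. f' x + g' x"] flat_algebra.intros) (auto intro!: derivative_intros)
next
  case (mult f g)
  then obtain f' g' where "f' \<in> flat_algebra" "g' \<in> flat_algebra"
    "\<And>x. (f has_real_derivative f' x) (at x)" "\<And>x. (g has_real_derivative g' x) (at x)"
    by blast
  then show ?case using mult
    by (intro bexI[of _ "\<lambda>x. f' x * g x + g' x * f x"] flat_algebra.intros ballI allI DERIV_mult)
qed

lemma flat_algebra_smooth: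
  assumes "f \<in> flat_algebra"
  shows "(deriv ^^ n) f field_differentiable (at x)"
proof -
  have "(deriv ^^ n) f \<in> flat_algebra"
  proof (induction n)
    case (Suc n)
    obtain g where g: "g \<in> flat_algebra" "\<And>x. ((deriv ^^ n) f has_real_derivative g x) (at x)"
      using flat_algebra_DERIV[OF Suc] by blast
    have "deriv ((deriv ^^ n) f) = g"
      using g(2) by (auto intro!: DERIV_imp_deriv)
    with g(1) show ?case by simp
  qed (use assms in auto)
  from flat_algebra_DERIV[OF this] show ?thesis
    by (auto simp: field_differentiable_def)
qed

lemma flat_algebra_continuous: "f \<in> flat_algebra \<Longrightarrow> continuous_on A f"
  by (metis DERIV_isCont continuous_at_imp_continuous_on flat_algebra_DERIV)

lemma test_functionI:
  assumes "\<phi> \<in> flat_algebra" "0 < a" "a < b" "b < 1" "\<And>x. x \<notin> {a..b} \<Longrightarrow> \<phi> x = 0"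
  shows "test_function \<phi>"
  using assms flat_algebra_smooth unfolding test_function_def by blast

text \<open>For \<open>n \<rightarrow> \<infinity>\<close> these bumps increase to the indicator of the open interval from \<open>a\<close> to \<open>b\<close>, which transfers
  statements about test functions to intervals.\<close>

definition bump :: "real \<Rightarrow> real \<Rightarrow> nat \<Rightarrow> real \<Rightarrow> real" where
  "bump a b n x = flat 0 (n * (x - a)) * flat 0 (n * (b - x))"

lemma bump_in_flat_algebra: "bump a b n \<in> flat_algebra"
proof -
  have "(\<lambda>x. flat 0 (n * x + (- (n * a))) * flat 0 ((- n) * x + n * b)) \<in> flat_algebra" for n :: real
    by (intro flat_algebra.intros)
  from this[of "real n"] show ?thesis
    by (simp add: bump_def[abs_def] algebra_simps)
qed

lemma bump_outside: "x \<notin> {a<..<b} \<Longrightarrow> bump a b n x = 0"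
  by (auto simp: bump_def flat_def zero_less_mult_iff)

lemma bump_pos: "x \<in> {a<..<b} \<Longrightarrow> 0 < n \<Longrightarrow> 0 < bump a b n x"
  by (auto simp: bump_def flat_def)

lemma bump_bounds: "0 \<le> bump a b n x" "bump a b n x \<le> 1"
proof -
  have *: "0 \<le> flat 0 y" "flat 0 y \<le> 1" for y
    by (auto simp: flat_def)
  show "0 \<le> bump a b n x" "bump a b n x \<le> 1"
    using mult_mono[OF *(2) *(2)] * by (auto simp: bump_def)
qed

lemma bump_tendsto_indicator: "(\<lambda>n. bump a b n x) \<longlonglongrightarrow> indicator {a<..<b} x"
proof -
  have *: "(\<lambda>n. flat 0 (real n * y)) \<longlonglongrightarrow> indicator {0<..} y" for y
  proof (cases "0 < y")
    case True
    have "(\<lambda>n. exp (- (inverse (real n) / y))) \<longlonglongrightarrow> exp (- (0 / y))"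
      by (intro tendsto_intros lim_inverse_n) (use True in auto)
    then have "(\<lambda>n. exp (- (inverse (real n) / y))) \<longlonglongrightarrow> 1" by simp
    then have "(\<lambda>n. flat 0 (real n * y)) \<longlonglongrightarrow> 1"
      by (rule Lim_transform_eventually)
         (use True in \<open>auto simp: flat_def field_simps intro!: eventually_sequentiallyI[of 1]\<close>)
    then show ?thesis using True by simp
  qed (auto simp: flat_def zero_less_mult_iff)
  have "(\<lambda>n. bump a b n x) \<longlonglongrightarrow> indicator {0<..} (x - a) * indicator {0<..} (b - x)"
    unfolding bump_def by (intro tendsto_mult *)
  then show ?thesis by (cases "a < x"; cases "x < b") simp_all
qed

lemma test_function_bump:
  assumes "0 < a" "a < b" "b < 1"
  shows "test_function (bump a b n)"
  using assms by (intro test_functionI[OF bump_in_flat_algebra, of a b] bump_outside) auto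

section \<open>Integration on the unit interval\<close>

lemma prob_space_Omega: "emeasure Omega (space Omega) = 1"
  by (simp add: emeasure_restrict_space space_restrict_space)

interpretation Omega: finite_measure Omega
  by (rule finite_measureI) (simp only: prob_space_Omega, simp)

lemma space_Omega [simp]: "space Omega = {0<..<1}"
  by (simp add: space_restrict_space)

lemma measure_Omega [simp]: "measure Omega {0<..<1} = 1"
  using prob_space_Omega by (simp add: measure_def)

lemma measurable_Omega: "f \<in> borel_measurable borel \<Longrightarrow> f \<in> borel_measurable Omega"
  by (rule measurable_restrict_space1) simp

lemma sets_Omega_Collect [measurable]: "{0<..<1} \<inter> A \<in> sets Omega" if "A \<in> sets borel"
  using that by (auto simp: sets_restrict_space)

lemma AE_Omega: "(AE x in Omega. P x) \<longleftrightarrow> (AE x in lborel. x \<in> {0<..<1} \<longrightarrow> P x)"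
  by (rule AE_restrict_space_iff) simp

lemma AE_Omega_interval: "AE x in Omega. x \<in> {0<..<1}"
  by (simp add: AE_Omega)

lemma AE_Omega_neq: "AE x in Omega. x \<noteq> c"
  using AE_lborel_singleton[of c] by (auto simp: AE_Omega)

lemma continuous_on_integrable_Omega:
  fixes f :: "real \<Rightarrow> 'a::{banach,second_countable_topology}"
  assumes "continuous_on {0..1} f"
  shows "integrable Omega f"
proof -
  have "set_integrable lborel {0..1} f"
    by (rule borel_integrable_atLeastAtMost'[OF assms])
  then have "set_integrable lborel {0<..<1} f"
    by (rule set_integrable_subset) auto
  then show ?thesis
    by (simp add: integrable_restrict_space set_integrable_def)
qed

text \<open>Exchanging integrals over \<open>y < x\<close> leaves an inner integral over \<open>{y<..1}\<close>, hence the half-open interval.\<close>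

lemma integral_Omega_FTC:
  fixes F :: "real \<Rightarrow> 'a::euclidean_space"
  assumes F: "\<And>x. x \<in> {0..1} \<Longrightarrow> (F has_vector_derivative f x) (at x within {0..1})"
    and f: "continuous_on {0..1} f" and ab: "0 \<le> a" "a \<le> b" "b \<le> 1"
  shows "(LINT x|Omega. indicator {a<..b} x *\<^sub>R f x) = F b - F a"
proof -
  have "(LINT x|Omega. indicator {a<..b} x *\<^sub>R f x) =
      (LINT x|lborel. indicator {0<..<1} x *\<^sub>R (indicator {a<..b} x *\<^sub>R f x))"
    by (simp add: integral_restrict_space)
  also have "\<dots> = (LINT x|lborel. indicator {a..b} x *\<^sub>R f x)"
  proof (rule integral_cong_AE)
    have "(\<lambda>x. indicator {0..1} x *\<^sub>R f x) \<in> borel_measurable borel"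
      by (rule borel_measurable_continuous_on_indicator[OF _ f]) simp
    from this[measurable] have meas:
      "(\<lambda>x. indicator A x *\<^sub>R (indicator {0..1} x *\<^sub>R f x)) \<in> borel_measurable lborel"
      if "A \<in> sets borel" for A
      using that by measurable
    have "(\<lambda>x. indicator {0<..<1} x *\<^sub>R (indicator {a<..b} x *\<^sub>R f x)) =
        (\<lambda>x. indicator ({0<..<1} \<inter> {a<..b}) x *\<^sub>R (indicator {0..1} x *\<^sub>R f x))"
      by (auto simp: indicator_def fun_eq_iff)
    then show "(\<lambda>x. indicator {0<..<1} x *\<^sub>R (indicator {a<..b} x *\<^sub>R f x)) \<in> borel_measurable lborel"
      by (simp only:) (rule meas, simp)
    have "(\<lambda>x. indicator {a..b} x *\<^sub>R f x) =
        (\<lambda>x. indicator {a..b} x *\<^sub>R (indicator {0..1} x *\<^sub>R f x))"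
      using ab by (auto simp: indicator_def fun_eq_iff)
    then show "(\<lambda>x. indicator {a..b} x *\<^sub>R f x) \<in> borel_measurable lborel"
      by (simp only:) (rule meas, simp)
    show "AE x in lborel. indicator {0<..<1} x *\<^sub>R (indicator {a<..b} x *\<^sub>R f x) =
        indicator {a..b} x *\<^sub>R f x"
      using AE_lborel_singleton[of a] AE_lborel_singleton[of b]
      by eventually_elim (use ab in \<open>auto simp: indicator_def\<close>)
  qed
  also have "\<dots> = F b - F a"
    using ab
    by (intro integral_FTC_atLeastAtMost)
       (auto intro: continuous_on_subset[OF f] has_vector_derivative_within_subset[OF F])
  finally show ?thesis .
qed

lemma integral_Omega_FTC_full:
  fixes F :: "real \<Rightarrow> 'a::euclidean_space"
  assumes "\<And>x. x \<in> {0..1} \<Longrightarrow> (F has_vector_derivative f x) (at x within {0..1})"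
    and "continuous_on {0..1} f"
  shows "(LINT x|Omega. f x) = F 1 - F 0"
proof -
  have "(LINT x|Omega. f x) = (LINT x|Omega. indicator {0<..1} x *\<^sub>R f x)"
    by (rule Bochner_Integration.integral_cong) auto
  then show ?thesis
    using integral_Omega_FTC[OF assms, of 0 1] by simp
qed

lemma test_function_C1:
  assumes "test_function \<phi>"
  shows "continuous_on A \<phi>" "continuous_on A (deriv \<phi>)"
    "(\<phi> has_real_derivative deriv \<phi> x) (at x)"
proof -
  have 0: "(deriv ^^ n) \<phi> field_differentiable (at x)" for n x
    using assms by (auto simp: test_function_def)
  have *: "continuous_on A ((deriv ^^ n) \<phi>)" for n
    using 0 by (intro continuous_at_imp_continuous_on ballI field_differentiable_imp_continuous_at) auto
  show "continuous_on A \<phi>" "continuous_on A (deriv \<phi>)" using *[of 0] *[of 1] by auto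
  show "(\<phi> has_real_derivative deriv \<phi> x) (at x)"
    using 0[of 0] by (simp add: field_differentiable_derivI)
qed

lemma continuous_on_bump: "continuous_on A (bump a b n)"
  by (rule flat_algebra_continuous[OF bump_in_flat_algebra])

section \<open>The lemma of du Bois-Reymond\<close>

text \<open>Intervals form a \<open>\<pi>\<close>-system that generates the Borel sets, so the integral vanishes over all Borel sets.
  Intervals that reach 0 or 1 are exhausted from inside.\<close>

lemma integral_zero_on_intervals_imp_AE_zero:
  fixes h :: "real \<Rightarrow> 'a::{banach,second_countable_topology}"
  assumes h: "integrable Omega h"
    and 0: "\<And>a b. 0 < a \<Longrightarrow> a < b \<Longrightarrow> b < 1 \<Longrightarrow> (LINT x|Omega. indicator {a<..<b} x *\<^sub>R h x) = 0"
  shows "AE x in Omega. h x = 0"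
proof -
  define I where "I A = (LINT x|Omega. indicator A x *\<^sub>R h x)" for A :: "real set"
  have int: "integrable Omega (\<lambda>x. indicator A x *\<^sub>R h x)" if "A \<in> sets borel" for A
  proof -
    have "A \<inter> space Omega \<in> sets Omega"
      using sets_Omega_Collect[OF that] by (simp add: Int_commute)
    then show ?thesis
      using integrable_mult_indicator[OF _ h, of "A \<inter> space Omega"]
      by (subst Bochner_Integration.integrable_cong[OF refl, where g = "\<lambda>x. indicator (A \<inter> space Omega) x *\<^sub>R h x"])
         (auto simp: indicator_def)
  qed
  have lim: "(\<lambda>n. I (X n)) \<longlonglongrightarrow> I A"
    if X: "\<And>n. X n \<in> sets borel" "A \<in> sets borel"
      "\<And>x. x \<in> {0<..<1} \<Longrightarrow> (\<lambda>n. indicator (X n) x) \<longlonglongrightarrow> (indicator A x :: real)" for X A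
    unfolding I_def
  proof (rule integral_dominated_convergence[where w = "\<lambda>x. norm (h x)"])
    show "AE x in Omega. (\<lambda>n. indicator (X n) x *\<^sub>R h x) \<longlonglongrightarrow> indicator A x *\<^sub>R h x"
      using AE_Omega_interval
      by eventually_elim (auto intro!: tendsto_intros X(3))
  qed (use int[OF X(1)] int[OF X(2)] h in \<open>auto simp: indicator_def\<close>)
  have interval: "I {a<..<b} = 0" for a b
  proof -
    let ?X = "\<lambda>n. {max a (1 / real (n + 3))<..<min b (1 - 1 / real (n + 3))}"
    have "(\<lambda>n. I (?X n)) \<longlonglongrightarrow> I {a<..<b}"
    proof (rule lim)
      fix x :: real assume x: "x \<in> {0<..<1}"
      have "(\<lambda>n. 1 / real (n + 3)) \<longlonglongrightarrow> 0"
        using LIMSEQ_ignore_initial_segment[OF lim_1_over_n, of 3] by simp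
      then have "\<forall>\<^sub>F n in sequentially. 1 / real (n + 3) < min x (1 - x)"
        by (rule order_tendstoD) (use x in auto)
      then have "\<forall>\<^sub>F n in sequentially. indicator (?X n) x = (indicator {a<..<b} x :: real)"
        by eventually_elim (use x in \<open>auto simp: indicator_def\<close>)
      then show "(\<lambda>n. indicator (?X n) x) \<longlonglongrightarrow> (indicator {a<..<b} x :: real)"
        by (rule tendsto_eventually)
    qed auto
    moreover have "I (?X n) = 0" for n
    proof (cases "?X n = {}")
      case False
      then have "max a (1 / real (n + 3)) < min b (1 - 1 / real (n + 3))"
        by (simp only: greaterThanLessThan_empty_iff not_le)
      moreover have "0 < 1 / real (n + 3)" by simp
      ultimately show ?thesis
        unfolding I_def by (intro 0) linarith+
    qed (simp add: I_def)
    ultimately show ?thesis by (simp add: LIMSEQ_const_iff)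
  qed
  have sb: "sigma_sets UNIV (range (\<lambda>(a, b). {a<..<b}) :: real set set) = sets borel"
    by (simp add: borel_eq_box box_real)
  have I_Un: "I (A \<union> B) = I A + I B"
    if "A \<in> sets borel" "B \<in> sets borel" "A \<inter> B = {}" for A B
  proof -
    have "indicator (A \<union> B) x *\<^sub>R h x = indicator A x *\<^sub>R h x + indicator B x *\<^sub>R h x" for x
      using that(3) by (auto simp: indicator_def)
    then show ?thesis
      unfolding I_def using int that by simp
  qed
  have I_UNIV: "I UNIV = 0"
    using interval[of 0 1] unfolding I_def
    by (subst Bochner_Integration.integral_cong[OF refl, where g = "\<lambda>x. indicator {0<..<1} x *\<^sub>R h x"]) auto
  have stable: "Int_stable (range (\<lambda>(a, b). {a<..<b}) :: real set set)"
    by (auto simp: Int_stable_def)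
  have sub: "(range (\<lambda>(a, b). {a<..<b}) :: real set set) \<subseteq> Pow UNIV" by auto
  have I_0: "I A = 0" if "A \<in> sets borel" for A
    using stable sub that[folded sb]
  proof (induction rule: sigma_sets_induct_disjoint)
    case (basic A)
    then show ?case using interval by auto
  next
    case empty
    show ?case by (simp add: I_def)
  next
    case (compl A)
    then have "I (A \<union> (UNIV - A)) = I A + I (UNIV - A)"
      unfolding sb by (intro I_Un) (blast, metis borel_comp Compl_eq_Diff_UNIV, blast)
    moreover have "A \<union> (UNIV - A) = UNIV" by blast
    ultimately show ?case using compl I_UNIV by simp
  next
    case (union A)
    then have A: "A i \<in> sets borel" for i
      unfolding sb by blast
    have "I (\<Union>i<n. A i) = 0" for n
    proof (induction n)
      case (Suc n)
      have "(\<Union>i<n. A i) \<inter> A n = {}"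
      proof -
        have "A i \<inter> A n = {}" if "i < n" for i
          using union(1) that unfolding disjoint_family_on_def by (metis UNIV_I less_irrefl)
        then show ?thesis by blast
      qed
      then have "I ((\<Union>i<n. A i) \<union> A n) = I (\<Union>i<n. A i) + I (A n)"
        using A by (intro I_Un) auto
      with Suc union(3) show ?case by (simp add: lessThan_Suc Un_commute)
    qed (simp add: I_def)
    moreover have "(\<lambda>n. I (\<Union>i<n. A i)) \<longlonglongrightarrow> I (\<Union>i. A i)"
    proof (rule lim)
      fix x :: real
      show "(\<lambda>n. indicator (\<Union>i<n. A i) x) \<longlonglongrightarrow> (indicator (\<Union>i. A i) x :: real)"
        by (rule LIMSEQ_indicator_UN)
    qed (use A in auto)
    ultimately show ?case by (simp add: LIMSEQ_const_iff)
  qed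
  show ?thesis
  proof (rule Omega.density_zero[OF h])
    fix A assume "A \<in> sets Omega"
    then have "A \<in> sets borel" by (auto simp: sets_restrict_space)
    from I_0[OF this] show "set_lebesgue_integral Omega A h = 0"
      by (simp add: set_lebesgue_integral_def I_def)
  qed
qed

lemma integral_test_functions_zero_imp_AE_zero:
  fixes h :: "real \<Rightarrow> complex"
  assumes h: "integrable Omega h"
    and 0: "\<And>a b n. 0 < a \<Longrightarrow> a < b \<Longrightarrow> b < 1 \<Longrightarrow>
      (LINT x|Omega. h x * complex_of_real (bump a b n x)) = 0"
  shows "AE x in Omega. h x = 0"
proof (rule integral_zero_on_intervals_imp_AE_zero[OF h])
  fix a b :: real assume ab: "0 < a" "a < b" "b < 1"
  have [measurable]: "(\<lambda>x. bump a b n x) \<in> borel_measurable Omega" for n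
    by (intro measurable_Omega borel_measurable_continuous_onI continuous_on_bump)
  have [measurable]: "h \<in> borel_measurable Omega" using h by auto
  have "(\<lambda>n. LINT x|Omega. h x * complex_of_real (bump a b n x))
      \<longlonglongrightarrow> (LINT x|Omega. h x * complex_of_real (indicator {a<..<b} x))"
  proof (rule integral_dominated_convergence[where w = "\<lambda>x. norm (h x)"])
    have "{0<..<1} \<inter> {a<..<b} \<in> sets Omega" by (rule sets_Omega_Collect) auto
    moreover have "{0<..<1} \<inter> {a<..<b} = {a<..<b}" using ab by auto
    ultimately have [measurable]: "{a<..<b} \<in> sets Omega" by simp
    show "(\<lambda>x. h x * complex_of_real (indicator {a<..<b} x)) \<in> borel_measurable Omega"
      by measurable
    show "AE x in Omega. (\<lambda>n. h x * complex_of_real (bump a b n x))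
        \<longlonglongrightarrow> h x * complex_of_real (indicator {a<..<b} x)"
      by (intro AE_I2 tendsto_intros bump_tendsto_indicator)
    show "AE x in Omega. norm (h x * complex_of_real (bump a b n x)) \<le> norm (h x)" for n
      using bump_bounds by (intro AE_I2) (auto simp: norm_mult intro!: mult_left_le)
  qed (use h in \<open>auto\<close>)
  with 0[OF ab] show "(LINT x|Omega. indicator {a<..<b} x *\<^sub>R h x) = 0"
    by (simp add: LIMSEQ_const_iff scaleR_conv_of_real mult.commute)
qed

text \<open>A test function with mean zero is the derivative of a test function. Every bump minus a suitable multiple
  of a fixed bump \<open>\<eta>\<close> has mean zero, so \<open>w - c\<close> is orthogonal to all bumps when \<open>c\<close> is the \<open>\<eta>\<close>-average of \<open>w\<close>.\<close>

lemma du_Bois_Reymond: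
  fixes w :: "real \<Rightarrow> complex"
  assumes w: "integrable Omega w"
    and 0: "\<And>\<phi>. test_function \<phi> \<Longrightarrow> (LINT x|Omega. w x * complex_of_real (deriv \<phi> x)) = 0"
  shows "\<exists>c. AE x in Omega. w x = c"
proof -
  let ?\<eta> = "bump (1/4) (3/4) 1"
  define E where "E = (LINT x|Omega. ?\<eta> x)"
  have int: "integrable Omega (bump a b n)" for a b n
    by (intro continuous_on_integrable_Omega continuous_on_bump)
  have "E \<noteq> 0"
  proof
    assume "E = 0"
    then have "AE x in Omega. ?\<eta> x = 0"
      unfolding E_def using int bump_bounds
      by (subst (asm) integral_nonneg_eq_0_iff_AE) auto
    then have "AE x in Omega. x \<notin> {1/4<..<3/4}"
      using bump_pos[of _ "1/4" "3/4" 1] by - (erule AE_mp, fastforce intro!: AE_I2)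
    then have "AE x in lborel. x \<notin> {1/4<..<3/4::real}"
      unfolding AE_Omega by eventually_elim auto
    then have "{1/4<..<3/4::real} \<in> null_sets lborel"
      by (subst AE_iff_null_sets) auto
    from null_setsD1[OF this] show False by simp
  qed
  define wE where "wE = (LINT x|Omega. w x * complex_of_real (?\<eta> x))"
  define c where "c = wE / complex_of_real E"
  have [measurable]: "w \<in> borel_measurable Omega" using w by auto
  have [measurable]: "bump a b n \<in> borel_measurable Omega" for a b n
    using int by auto
  have intw: "integrable Omega (\<lambda>x. w x * complex_of_real (bump a b n x))" for a b n
    by (rule Bochner_Integration.integrable_bound[OF w])
       (use bump_bounds in \<open>auto simp: norm_mult intro!: AE_I2 mult_left_le\<close>)
  have "AE x in Omega. w x - c = 0"
  proof (rule integral_test_functions_zero_imp_AE_zero)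
    show "integrable Omega (\<lambda>x. w x - c)" using w by auto
    fix a b :: real and n assume ab: "0 < a" "a < b" "b < 1"
    define m where "m = (LINT x|Omega. bump a b n x)"
    define \<psi> where "\<psi> x = bump a b n x - m / E * ?\<eta> x" for x
    have \<psi>: "\<psi> \<in> flat_algebra"
    proof -
      have "(\<lambda>x. bump a b n x + (- (m / E)) * ?\<eta> x) \<in> flat_algebra"
        by (intro flat_algebra.intros bump_in_flat_algebra)
      then show ?thesis by (simp add: \<psi>_def[abs_def])
    qed
    have \<psi>_int: "(LINT x|Omega. \<psi> x) = 0"
    proof -
      have "(LINT x|Omega. \<psi> x) = m - m / E * E"
        unfolding \<psi>_def m_def E_def using int by simp
      then show ?thesis using \<open>E \<noteq> 0\<close> by simp
    qed
    \<comment> \<open>The normalisation at 0 makes \<open>\<Phi>\<close> vanish on both sides of the support of \<open>\<psi>\<close>, which has mean zero.\<close>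
    obtain \<Phi> where \<Phi>: "\<Phi> 0 = 0" "\<And>x. (\<Phi> has_real_derivative \<psi> x) (at x)"
    proof -
      have "\<exists>F. \<forall>x::real. -\<infinity> < ereal x \<longrightarrow> ereal x < \<infinity> \<longrightarrow> (F has_vector_derivative \<psi> x) (at x)"
        using flat_algebra_continuous[OF \<psi>, of UNIV]
        by (intro einterval_antiderivative) (auto simp: continuous_on_eq_continuous_at)
      then obtain F where "\<And>x. (F has_real_derivative \<psi> x) (at x)"
        by (auto simp: has_real_derivative_iff_has_vector_derivative)
      then show thesis
        by (intro that[of "\<lambda>x. F x - F 0"]) (auto intro!: derivative_eq_intros)
    qed
    define \<alpha> \<beta> where "\<alpha> = min a (1/4)" and "\<beta> = max b (3/4)"
    have \<psi>0: "\<psi> x = 0" if "x \<notin> {\<alpha><..<\<beta>}" for x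
    proof -
      from that have "x \<notin> {a<..<b}" "x \<notin> {1/4<..<3/4}"
        unfolding \<alpha>_def \<beta>_def greaterThanLessThan_iff by linarith+
      then have "bump a b n x = 0" "?\<eta> x = 0" by (blast intro: bump_outside)+
      then show ?thesis by (simp add: \<psi>_def del: One_nat_def)
    qed
    have \<Phi>1: "\<Phi> 1 = 0"
      using integral_Omega_FTC_full[of \<Phi> \<psi>] \<psi>_int \<Phi> flat_algebra_continuous[OF \<psi>]
      by (auto simp: has_real_derivative_iff_has_vector_derivative has_vector_derivative_at_within)
    have \<Phi>_deriv: "deriv \<Phi> = \<psi>"
      using \<Phi>(2) by (auto intro!: DERIV_imp_deriv)
    have const: "\<Phi> x = \<Phi> y" if "convex S" "x \<in> S" "y \<in> S" "\<And>z. z \<in> S \<Longrightarrow> \<psi> z = 0" for S x y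
    proof -
      have "(\<Phi> has_field_derivative 0) (at z within S)" if "z \<in> S" for z
        using \<Phi>(2)[of z] \<open>\<And>z. z \<in> S \<Longrightarrow> \<psi> z = 0\<close>[OF that]
        by (auto intro: has_field_derivative_at_within)
      then show ?thesis
        using has_field_derivative_zero_constant[OF \<open>convex S\<close>, of \<Phi>] that by auto
    qed
    have smooth: "(deriv ^^ k) \<Phi> field_differentiable (at x)" for k x
    proof (cases k)
      case 0
      then show ?thesis using \<Phi>(2) by (auto simp: field_differentiable_def)
    next
      case (Suc j)
      then show ?thesis
        using flat_algebra_smooth[OF \<psi>, of j x] by (simp add: funpow_Suc_right \<Phi>_deriv del: funpow.simps)
    qed
    have outside: "\<Phi> x = 0" if x: "x \<notin> {\<alpha>..\<beta>}" for x
    proof (cases "x < \<alpha>")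
      case True
      then have "\<Phi> x = \<Phi> 0"
        using ab by (intro const[of "{..\<alpha>}"] \<psi>0) (auto simp: \<alpha>_def)
      then show ?thesis using \<Phi> by simp
    next
      case False
      then have "\<Phi> x = \<Phi> 1"
        using ab x by (intro const[of "{\<beta>..}"] \<psi>0) (auto simp: \<beta>_def)
      then show ?thesis using \<Phi>1 by simp
    qed
    have "0 < \<alpha>" "\<alpha> < \<beta>" "\<beta> < 1"
      using ab by (auto simp: \<alpha>_def \<beta>_def)
    with smooth outside have "test_function \<Phi>"
      unfolding test_function_def by blast
    from 0[OF this] have "(LINT x|Omega. w x * complex_of_real (bump a b n x) -
        complex_of_real (m / E) * (w x * complex_of_real (?\<eta> x))) = 0"
      by (simp add: \<Phi>_deriv \<psi>_def algebra_simps)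
    then have "(LINT x|Omega. w x * complex_of_real (bump a b n x)) = complex_of_real (m / E) * wE"
      using intw by (simp add: wE_def)
    moreover have "(LINT x|Omega. (w x - c) * complex_of_real (bump a b n x)) =
        (LINT x|Omega. w x * complex_of_real (bump a b n x)) - c * complex_of_real m"
    proof -
      have "(LINT x|Omega. (w x - c) * complex_of_real (bump a b n x)) =
        (LINT x|Omega. w x * complex_of_real (bump a b n x) - c * complex_of_real (bump a b n x))"
        by (simp add: algebra_simps)
      then show ?thesis
        using intw[of a b n] int[of a b n] by (simp add: m_def)
    qed
    ultimately show "(LINT x|Omega. (w x - c) * complex_of_real (bump a b n x)) = 0"
      by (simp add: c_def)
  qed
  then show ?thesis by auto
qed

section \<open>Square integrable functions\<close>

lemma L2_measurable: "f \<in> L2 M \<Longrightarrow> f \<in> borel_measurable M"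
  and L2_integrable_square: "f \<in> L2 M \<Longrightarrow> integrable M (\<lambda>x. (cmod (f x))\<^sup>2)"
  by (auto simp: L2_def)

lemma L2_integrable_mult:
  assumes "f \<in> L2 M" "g \<in> L2 M"
  shows "integrable M (\<lambda>x. f x * g x)"
proof (rule Bochner_Integration.integrable_bound)
  show "integrable M (\<lambda>x. (cmod (f x))\<^sup>2 + (cmod (g x))\<^sup>2)"
    using assms by (auto simp: L2_def)
  show "AE x in M. norm (f x * g x) \<le> norm ((cmod (f x))\<^sup>2 + (cmod (g x))\<^sup>2)"
  proof (rule AE_I2)
    fix x
    have "2 * cmod (f x) * cmod (g x) \<le> (cmod (f x))\<^sup>2 + (cmod (g x))\<^sup>2"
      by (rule sum_squares_bound)
    moreover have "0 \<le> cmod (f x) * cmod (g x)" by simp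
    ultimately have "cmod (f x) * cmod (g x) \<le> (cmod (f x))\<^sup>2 + (cmod (g x))\<^sup>2"
      by linarith
    then show "norm (f x * g x) \<le> norm ((cmod (f x))\<^sup>2 + (cmod (g x))\<^sup>2)"
      by (simp add: norm_mult)
  qed
qed (use assms in \<open>auto simp: L2_def\<close>)

lemma L2_scale: "f \<in> L2 M \<Longrightarrow> (\<lambda>x. c * f x) \<in> L2 M"
  by (auto simp: L2_def norm_mult power_mult_distrib)

lemma L2_dominated:
  assumes "f \<in> L2 M" "g \<in> borel_measurable M" "AE x in M. cmod (g x) \<le> c * cmod (f x)"
  shows "g \<in> L2 M"
proof -
  have "integrable M (\<lambda>x. (cmod (g x))\<^sup>2)"
  proof (rule Bochner_Integration.integrable_bound)
    show "integrable M (\<lambda>x. c\<^sup>2 * (cmod (f x))\<^sup>2)"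
      using assms by (auto simp: L2_def)
    show "AE x in M. norm ((cmod (g x))\<^sup>2) \<le> norm (c\<^sup>2 * (cmod (f x))\<^sup>2)"
      using assms(3)
    proof eventually_elim
      case (elim x)
      from power_mono[OF this, of 2] show ?case by (simp add: power_mult_distrib)
    qed
  qed (use assms in auto)
  then show ?thesis using assms by (simp add: L2_def)
qed

lemma L2_add:
  assumes "f \<in> L2 M" "g \<in> L2 M"
  shows "(\<lambda>x. f x + g x) \<in> L2 M"
proof -
  have "integrable M (\<lambda>x. (cmod (f x + g x))\<^sup>2)"
  proof (rule Bochner_Integration.integrable_bound)
    show "integrable M (\<lambda>x. 2 * (cmod (f x))\<^sup>2 + 2 * (cmod (g x))\<^sup>2)"
      using assms by (auto simp: L2_def)
    show "AE x in M. norm ((cmod (f x + g x))\<^sup>2) \<le> norm (2 * (cmod (f x))\<^sup>2 + 2 * (cmod (g x))\<^sup>2)"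
    proof (rule AE_I2)
      fix x
      have "(cmod (f x + g x))\<^sup>2 \<le> (cmod (f x) + cmod (g x))\<^sup>2"
        by (intro power_mono norm_triangle_ineq) auto
      also have "\<dots> \<le> 2 * (cmod (f x))\<^sup>2 + 2 * (cmod (g x))\<^sup>2"
        using sum_squares_bound[of "cmod (f x)" "cmod (g x)"] by (simp add: power2_sum)
      finally show "norm ((cmod (f x + g x))\<^sup>2) \<le> norm (2 * (cmod (f x))\<^sup>2 + 2 * (cmod (g x))\<^sup>2)"
        by simp
    qed
  qed (use assms in \<open>auto simp: L2_def\<close>)
  then show ?thesis using assms by (auto simp: L2_def)
qed

lemma L2_diff: "f \<in> L2 M \<Longrightarrow> g \<in> L2 M \<Longrightarrow> (\<lambda>x. f x - g x) \<in> L2 M"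
  using L2_add[OF _ L2_scale[of g M "-1"], of f] by simp

lemma L2_zero [simp]: "(\<lambda>x. 0) \<in> L2 M"
  by (simp add: L2_def)

text \<open>The Cauchy-Schwarz inequality, in the form used for given bounds. Young's inequality with weight \<open>B/A\<close> needs
  \<open>A\<close> and \<open>B\<close> to be positive, hence the passage to slightly larger bounds.\<close>

lemma integral_mult_le_L2:
  assumes f: "f \<in> L2 M" and g: "g \<in> L2 M"
    and A: "(LINT x|M. (cmod (f x))\<^sup>2) \<le> A\<^sup>2" "0 \<le> A"
    and B: "(LINT x|M. (cmod (g x))\<^sup>2) \<le> B\<^sup>2" "0 \<le> B"
  shows "(LINT x|M. cmod (f x) * cmod (g x)) \<le> A * B"
proof -
  \<comment> \<open>Young's inequality with the weight that makes it sharp at the bounds.\<close>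
  have young: "(LINT x|M. cmod (f x) * cmod (g x)) \<le> A' * B'" if "A < A'" "B < B'" for A' B'
  proof -
    have pos: "0 < A'" "0 < B'" using that A B by auto
    have "cmod (f x) * cmod (g x) \<le> (B' / A' * (cmod (f x))\<^sup>2 + A' / B' * (cmod (g x))\<^sup>2) / 2" for x
    proof -
      have "0 \<le> (B' * cmod (f x) - A' * cmod (g x))\<^sup>2" by simp
      with pos show ?thesis by (simp add: field_simps power2_eq_square)
    qed
    then have "(LINT x|M. cmod (f x) * cmod (g x)) \<le>
        (LINT x|M. (B' / A' * (cmod (f x))\<^sup>2 + A' / B' * (cmod (g x))\<^sup>2) / 2)"
      using f g integrable_norm[OF L2_integrable_mult[OF f g]]
      by (intro integral_mono) (auto simp: L2_def norm_mult)
    also have "\<dots> = (B' / A' * (LINT x|M. (cmod (f x))\<^sup>2) + A' / B' * (LINT x|M. (cmod (g x))\<^sup>2)) / 2"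
      using f g by (simp add: L2_def)
    also have "\<dots> \<le> (B' / A' * A'\<^sup>2 + A' / B' * B'\<^sup>2) / 2"
    proof -
      have "A\<^sup>2 \<le> A'\<^sup>2" "B\<^sup>2 \<le> B'\<^sup>2" using that A B by (auto intro!: power_mono)
      then have "(LINT x|M. (cmod (f x))\<^sup>2) \<le> A'\<^sup>2" "(LINT x|M. (cmod (g x))\<^sup>2) \<le> B'\<^sup>2"
        using A(1) B(1) by linarith+
      then show ?thesis using pos
        by (intro divide_right_mono add_mono mult_left_mono) auto
    qed
    also have "\<dots> = A' * B'" using pos by (simp add: power2_eq_square)
    finally show ?thesis .
  qed
  have "((\<lambda>\<epsilon>. (A + \<epsilon>) * (B + \<epsilon>)) \<longlongrightarrow> (A + 0) * (B + 0)) (at_right 0)"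
    by (intro tendsto_intros)
  moreover have "\<forall>\<^sub>F \<epsilon> in at_right 0. (LINT x|M. cmod (f x) * cmod (g x)) \<le> (A + \<epsilon>) * (B + \<epsilon>)"
    using eventually_at_right_less[of 0] by eventually_elim (intro young; simp)
  ultimately show ?thesis
    by (intro tendsto_lowerbound[where F = "at_right (0::real)"]) auto
qed

lemma continuous_on_L2_Omega:
  assumes "continuous_on {0..1} f"
  shows "f \<in> L2 Omega"
proof -
  have "integrable Omega f" "integrable Omega (\<lambda>x. (cmod (f x))\<^sup>2)"
    by (intro continuous_on_integrable_Omega continuous_intros assms)+
  then show ?thesis by (auto simp: L2_def)
qed

lemma L2_Omega_mult_continuous:
  assumes "g \<in> L2 Omega" "continuous_on {0..1} f"
  shows "(\<lambda>x. f x * g x) \<in> L2 Omega"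
proof -
  have "compact (f ` {0..1})" by (intro compact_continuous_image assms) auto
  then obtain B where B: "\<And>x. x \<in> {0..1} \<Longrightarrow> norm (f x) \<le> B"
    using compact_imp_bounded bounded_iff by (metis imageI)
  show ?thesis
  proof (rule L2_dominated[OF assms(1)])
    have "f \<in> borel_measurable Omega"
      using continuous_on_L2_Omega[OF assms(2)] by (rule L2_measurable)
    then show "(\<lambda>x. f x * g x) \<in> borel_measurable Omega"
      using L2_measurable[OF assms(1)] by simp
    show "AE x in Omega. cmod (f x * g x) \<le> B * cmod (g x)"
      using AE_Omega_interval
      by eventually_elim (use B in \<open>auto simp: norm_mult intro!: mult_right_mono\<close>)
  qed
qed

lemma L2_Omega_integrable: "f \<in> L2 Omega \<Longrightarrow> integrable Omega f"
  using L2_integrable_mult[OF _ continuous_on_L2_Omega[of "\<lambda>_. 1"], of f] by simp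

lemma L2_Omega_integral_norm_le:
  assumes "f \<in> L2 Omega" "(LINT x|Omega. (cmod (f x))\<^sup>2) \<le> A\<^sup>2" "0 \<le> A"
  shows "(LINT x|Omega. cmod (f x)) \<le> A"
  using integral_mult_le_L2[OF assms(1) continuous_on_L2_Omega[of "\<lambda>_. 1"] assms(2,3), of 1]
  by simp

section \<open>Primitives and integration by parts\<close>

definition primitive :: "(real \<Rightarrow> complex) \<Rightarrow> real \<Rightarrow> complex" where
  "primitive h x = (LINT y|Omega. indicator {..<x} y *\<^sub>R h y)"

lemma primitive_0 [simp]: "primitive h 0 = 0"
proof -
  have "(LINT y|Omega. indicator {..<0} y *\<^sub>R h y) = (LINT y|Omega. 0)"
    by (rule Bochner_Integration.integral_cong) auto
  then show ?thesis by (simp add: primitive_def)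
qed

lemma primitive_1: "primitive h 1 = (LINT y|Omega. h y)"
  unfolding primitive_def by (rule Bochner_Integration.integral_cong) auto

lemma indicator_lessThan_measurable_Omega [measurable]:
  "(\<lambda>y. indicator {..<x} y :: real) \<in> borel_measurable Omega"
  by (rule measurable_Omega) measurable

lemma integrable_Omega_lessThan:
  fixes h :: "real \<Rightarrow> complex"
  assumes "integrable Omega h"
  shows "integrable Omega (\<lambda>y. indicator {..<x} y *\<^sub>R h y)"
proof (rule Bochner_Integration.integrable_bound[OF assms])
  have [measurable]: "h \<in> borel_measurable Omega" using assms by auto
  show "(\<lambda>y. indicator {..<x} y *\<^sub>R h y) \<in> borel_measurable Omega" by measurable
qed (auto simp: indicator_def)

lemma continuous_on_primitive:
  assumes h: "integrable Omega h"
  shows "continuous_on A (primitive h)"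
proof (intro continuous_at_imp_continuous_on ballI)
  fix x
  have [measurable]: "h \<in> borel_measurable Omega" using h by auto
  show "isCont (primitive h) x"
    unfolding continuous_at_sequentially comp_def primitive_def
  proof (intro allI impI)
    fix X assume X: "X \<longlonglongrightarrow> x"
    show "(\<lambda>n. LINT y|Omega. indicator {..<X n} y *\<^sub>R h y)
        \<longlonglongrightarrow> (LINT y|Omega. indicator {..<x} y *\<^sub>R h y)"
    proof (rule integral_dominated_convergence[where w = "\<lambda>x. norm (h x)"])
      show "AE y in Omega. (\<lambda>n. indicator {..<X n} y *\<^sub>R h y) \<longlonglongrightarrow> indicator {..<x} y *\<^sub>R h y"
        using AE_Omega_neq[of x]
      proof eventually_elim
        case (elim y)
        have "\<forall>\<^sub>F n in sequentially. indicator {..<X n} y = (indicator {..<x} y :: real)"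
        proof (cases "y < x")
          case True
          then show ?thesis using order_tendstoD(1)[OF X True] by (auto elim!: eventually_mono)
        next
          case False
          with elim have "x < y" by auto
          then show ?thesis
            using order_tendstoD(2)[OF X \<open>x < y\<close>] by (auto elim!: eventually_mono)
        qed
        then show ?case
          by (intro tendsto_scaleR tendsto_const tendsto_eventually)
      qed
      show "AE y in Omega. norm (indicator {..<X n} y *\<^sub>R h y) \<le> norm (h y)" for n
        by (simp add: indicator_def)
    qed (intro borel_measurable_integrable integrable_Omega_lessThan integrable_norm h)+
  qed
qed

lemma norm_primitive_le:
  assumes h: "integrable Omega h"
  shows "cmod (primitive h x) \<le> (LINT y|Omega. cmod (h y))"
proof -
  have "cmod (primitive h x) \<le> (LINT y|Omega. cmod (indicator {..<x} y *\<^sub>R h y))"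
    unfolding primitive_def by (rule integral_norm_bound)
  also have "\<dots> \<le> (LINT y|Omega. cmod (h y))"
    using integrable_Omega_lessThan[OF h] h
    by (intro integral_mono integrable_norm) (auto simp: indicator_def)
  finally show ?thesis .
qed

text \<open>By Fubini on the triangle \<open>y < x\<close>. The test function \<open>\<phi>\<close> may be complex, which makes the product rule
  for weak derivatives available.\<close>

lemma integration_by_parts_primitive:
  fixes \<phi> :: "real \<Rightarrow> complex"
  assumes h: "integrable Omega h"
    and \<phi>: "\<And>x. x \<in> {0..1} \<Longrightarrow> (\<phi> has_vector_derivative \<phi>' x) (at x within {0..1})"
    and \<phi>': "continuous_on {0..1} \<phi>'"
  shows "(LINT x|Omega. (c + primitive h x) * \<phi>' x) =
    (c + primitive h 1) * \<phi> 1 - c * \<phi> 0 - (LINT x|Omega. h x * \<phi> x)"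
proof -
  interpret P: pair_sigma_finite Omega Omega
    by (intro pair_sigma_finite.intro Omega.sigma_finite_measure_axioms)
  have \<phi>_cont: "continuous_on {0..1} \<phi>"
    using \<phi> by (rule continuous_on_vector_derivative)
  have int\<phi>': "integrable Omega \<phi>'"
    by (rule continuous_on_integrable_Omega[OF \<phi>'])
  have [measurable]: "h \<in> borel_measurable Omega" "\<phi>' \<in> borel_measurable Omega"
    using h int\<phi>' by auto
  have intp: "integrable Omega (\<lambda>x. primitive h x * \<phi>' x)"
    by (intro continuous_on_integrable_Omega continuous_intros \<phi>' continuous_on_primitive h)
  have inth: "integrable Omega (\<lambda>x. h x * \<phi> x)"
  proof -
    have "compact (\<phi> ` {0..1})" by (intro compact_continuous_image \<phi>_cont) auto
    then obtain B where B: "\<And>x. x \<in> {0..1} \<Longrightarrow> norm (\<phi> x) \<le> B"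
      using compact_imp_bounded bounded_iff by (metis imageI)
    have [measurable]: "\<phi> \<in> borel_measurable Omega"
      using continuous_on_integrable_Omega[OF \<phi>_cont] by auto
    show ?thesis
    proof (rule Bochner_Integration.integrable_bound)
      show "integrable Omega (\<lambda>x. B * norm (h x))" using h by auto
      show "AE x in Omega. norm (h x * \<phi> x) \<le> norm (B * norm (h x))"
        using AE_Omega_interval
      proof eventually_elim
        case (elim x)
        with B[of x] have "norm (\<phi> x) * norm (h x) \<le> B * norm (h x)"
          by (intro mult_right_mono) auto
        then show ?case by (simp add: norm_mult mult.commute)
      qed
    qed measurable
  qed
  have "(LINT x|Omega. primitive h x * \<phi>' x) =
      (LINT x|Omega. LINT y|Omega. (indicator {y<..} x *\<^sub>R (h y * \<phi>' x)))"
  proof (rule Bochner_Integration.integral_cong[OF refl])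
    fix x
    have "(LINT y|Omega. (indicator {y<..} x *\<^sub>R (h y * \<phi>' x))) =
      (LINT y|Omega. (indicator {..<x} y *\<^sub>R h y) * \<phi>' x)"
      by (rule Bochner_Integration.integral_cong) (auto simp: indicator_def)
    also have "\<dots> = primitive h x * \<phi>' x"
      unfolding primitive_def by (rule integral_mult_left_zero)
    finally show "primitive h x * \<phi>' x = (LINT y|Omega. (indicator {y<..} x *\<^sub>R (h y * \<phi>' x)))" ..
  qed
  also have "\<dots> = (LINT y|Omega. LINT x|Omega. (indicator {y<..} x *\<^sub>R (h y * \<phi>' x)))"
  proof (rule P.Fubini_integral)
    have [measurable]: "(\<lambda>p. indicator {fst p<..} (snd p) :: real) \<in> borel_measurable (Omega \<Otimes>\<^sub>M Omega)"
    proof -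
      have [measurable]: "(\<lambda>x. x) \<in> borel_measurable Omega"
        by (rule measurable_Omega) simp
      have "(\<lambda>p. indicator {fst p<..} (snd p) :: real) = (\<lambda>p. if fst p < snd p then 1 else 0)"
        by (auto simp: indicator_def)
      also have "\<dots> \<in> borel_measurable (Omega \<Otimes>\<^sub>M Omega)"
        by measurable
      finally show ?thesis .
    qed
    have "integrable (Omega \<Otimes>\<^sub>M Omega) (\<lambda>(y, x). h y * \<phi>' x)"
      using h int\<phi>'
      by (intro P.Fubini_integrable) (auto simp: norm_mult intro!: integrable_mult_left integrable_norm)
    then show "integrable (Omega \<Otimes>\<^sub>M Omega) (\<lambda>(y, x). indicator {y<..} x *\<^sub>R (h y * \<phi>' x))"
    proof (rule Bochner_Integration.integrable_bound)
      show "(\<lambda>(y, x). indicator {y<..} x *\<^sub>R (h y * \<phi>' x)) \<in> borel_measurable (Omega \<Otimes>\<^sub>M Omega)"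
        unfolding split_beta' by measurable
    qed (auto simp: indicator_def)
  qed
  also have "\<dots> = (LINT y|Omega. h y * (\<phi> 1 - \<phi> y))"
  proof (rule Bochner_Integration.integral_cong[OF refl])
    fix y assume "y \<in> space Omega"
    then have y: "0 < y" "y < 1" by auto
    have "(LINT x|Omega. indicator {y<..} x *\<^sub>R (h y * \<phi>' x)) =
        (LINT x|Omega. h y * (indicator {y<..1} x *\<^sub>R \<phi>' x))"
      using y by (intro Bochner_Integration.integral_cong) (auto simp: indicator_def)
    also have "\<dots> = h y * (LINT x|Omega. indicator {y<..1} x *\<^sub>R \<phi>' x)"
      by (rule integral_mult_right_zero)
    also have "\<dots> = h y * (\<phi> 1 - \<phi> y)"
      using integral_Omega_FTC[OF \<phi> \<phi>', of y 1] y by simp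
    finally show "(LINT x|Omega. indicator {y<..} x *\<^sub>R (h y * \<phi>' x)) = h y * (\<phi> 1 - \<phi> y)" .
  qed
  also have "\<dots> = primitive h 1 * \<phi> 1 - (LINT x|Omega. h x * \<phi> x)"
    using h inth by (simp add: right_diff_distrib primitive_1)
  finally have "(LINT x|Omega. primitive h x * \<phi>' x) =
      primitive h 1 * \<phi> 1 - (LINT x|Omega. h x * \<phi> x)" .
  moreover have "(LINT x|Omega. c * \<phi>' x) = c * (\<phi> 1 - \<phi> 0)"
    using integral_Omega_FTC_full[OF \<phi> \<phi>'] by simp
  ultimately show ?thesis
    using intp int\<phi>' by (simp add: distrib_right algebra_simps)
qed

section \<open>Weak derivatives\<close>

lemma test_function_endpoints:
  assumes "test_function \<phi>"
  shows "\<phi> 0 = 0" "\<phi> 1 = 0"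
proof -
  obtain a b where ab: "0 < a" "a < b" "b < 1" "\<And>x. x \<notin> {a..b} \<Longrightarrow> \<phi> x = 0"
    using assms unfolding test_function_def by blast
  show "\<phi> 0 = 0" "\<phi> 1 = 0" using ab by (auto intro!: ab(4))
qed

lemma test_function_L2:
  assumes "test_function \<phi>"
  shows "(\<lambda>x. complex_of_real (\<phi> x)) \<in> L2 Omega" "(\<lambda>x. complex_of_real (deriv \<phi> x)) \<in> L2 Omega"
  by (intro continuous_on_L2_Omega continuous_on_of_real test_function_C1 assms)+

lemma weak_derivative_add:
  assumes "weak_derivative u g" "weak_derivative v h"
    and "u \<in> L2 Omega" "g \<in> L2 Omega" "v \<in> L2 Omega" "h \<in> L2 Omega"
  shows "weak_derivative (\<lambda>x. u x + v x) (\<lambda>x. g x + h x)"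
  unfolding weak_derivative_def
proof (intro allI impI)
  fix \<phi> assume \<phi>: "test_function \<phi>"
  note int = L2_integrable_mult[OF _ test_function_L2(1)[OF \<phi>]] L2_integrable_mult[OF _ test_function_L2(2)[OF \<phi>]]
  show "(LINT x|Omega. (u x + v x) * complex_of_real (deriv \<phi> x)) =
      - (LINT x|Omega. (g x + h x) * complex_of_real (\<phi> x))"
    using assms \<phi> by (simp add: distrib_right int weak_derivative_def)
qed

lemma weak_derivative_scale:
  assumes "weak_derivative u g"
  shows "weak_derivative (\<lambda>x. c * u x) (\<lambda>x. c * g x)"
  using assms by (simp add: weak_derivative_def mult.assoc)

lemma weak_derivative_diff:
  assumes "weak_derivative u g" "weak_derivative v h"
    and "u \<in> L2 Omega" "g \<in> L2 Omega" "v \<in> L2 Omega" "h \<in> L2 Omega"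
  shows "weak_derivative (\<lambda>x. u x - v x) (\<lambda>x. g x - h x)"
  using weak_derivative_add[OF assms(1) weak_derivative_scale[OF assms(2), of "-1"]
      assms(3,4) L2_scale[OF assms(5)] L2_scale[OF assms(6)]]
  by simp

lemma weak_derivative_cong_AE:
  assumes "weak_derivative u g"
    and "u \<in> borel_measurable Omega" "v \<in> borel_measurable Omega" "AE x in Omega. u x = v x"
    and "g \<in> borel_measurable Omega" "h \<in> borel_measurable Omega" "AE x in Omega. g x = h x"
  shows "weak_derivative v h"
  unfolding weak_derivative_def
proof (intro allI impI)
  fix \<phi> assume \<phi>: "test_function \<phi>"
  have [measurable]: "(\<lambda>x. complex_of_real (\<phi> x)) \<in> borel_measurable Omega"
    "(\<lambda>x. complex_of_real (deriv \<phi> x)) \<in> borel_measurable Omega"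
    using test_function_L2[OF \<phi>] by (auto dest: L2_measurable)
  note [measurable] = assms(2,3,5,6)
  have "(LINT x|Omega. v x * complex_of_real (deriv \<phi> x)) =
      (LINT x|Omega. u x * complex_of_real (deriv \<phi> x))"
    by (rule integral_cong_AE) (use assms(4) in \<open>auto elim!: eventually_mono\<close>)
  moreover have "(LINT x|Omega. h x * complex_of_real (\<phi> x)) =
      (LINT x|Omega. g x * complex_of_real (\<phi> x))"
    by (rule integral_cong_AE) (use assms(7) in \<open>auto elim!: eventually_mono\<close>)
  ultimately show "(LINT x|Omega. v x * complex_of_real (deriv \<phi> x)) =
      - (LINT x|Omega. h x * complex_of_real (\<phi> x))"
    using assms(1) \<phi> by (simp add: weak_derivative_def)
qed

lemma weak_derivative_unique:
  assumes "weak_derivative u g" "weak_derivative u h" "g \<in> L2 Omega" "h \<in> L2 Omega"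
  shows "AE x in Omega. g x = h x"
proof -
  have "AE x in Omega. g x - h x = 0"
  proof (rule integral_test_functions_zero_imp_AE_zero)
    show "integrable Omega (\<lambda>x. g x - h x)"
      using assms by (intro L2_Omega_integrable L2_diff)
    fix a b :: real and n assume "0 < a" "a < b" "b < 1"
    then have \<phi>: "test_function (bump a b n)" by (rule test_function_bump)
    have "(LINT x|Omega. g x * complex_of_real (bump a b n x)) = (LINT x|Omega. h x * complex_of_real (bump a b n x))"
      using assms(1)[unfolded weak_derivative_def, rule_format, OF \<phi>]
        assms(2)[unfolded weak_derivative_def, rule_format, OF \<phi>] by simp
    then show "(LINT x|Omega. (g x - h x) * complex_of_real (bump a b n x)) = 0"
      using assms(3,4) by (simp add: left_diff_distrib L2_integrable_mult test_function_L2[OF \<phi>])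
  qed
  then show ?thesis by simp
qed

text \<open>Moving the exponential to the test function reduces this to integration by parts.\<close>

lemma weak_derivative_exp_mult:
  assumes h: "h \<in> L2 Omega"
  shows "weak_derivative (\<lambda>x. exp (\<mu> * complex_of_real x) * (c + primitive h x))
    (\<lambda>x. exp (\<mu> * complex_of_real x) * (\<mu> * (c + primitive h x) + h x))"
  unfolding weak_derivative_def
proof (intro allI impI)
  fix \<phi> assume \<phi>: "test_function \<phi>"
  let ?E = "\<lambda>x. exp (\<mu> * complex_of_real x)" and ?W = "\<lambda>x. c + primitive h x"
  let ?\<phi> = "\<lambda>x. complex_of_real (\<phi> x)" and ?d = "\<lambda>x. complex_of_real (deriv \<phi> x)"
  note int = L2_Omega_integrable[OF h]
  note cont = test_function_C1(1,2)[OF \<phi>]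
  have "(LINT x|Omega. ?W x * (\<mu> * ?E x * ?\<phi> x + ?E x * ?d x)) =
      (c + primitive h 1) * (?E 1 * ?\<phi> 1) - c * (?E 0 * ?\<phi> 0) - (LINT x|Omega. h x * (?E x * ?\<phi> x))"
  proof (rule integration_by_parts_primitive[OF int])
    fix x :: real
    have "(?\<phi> has_vector_derivative ?d x) (at x within {0..1})"
      using test_function_C1(3)[OF \<phi>, of x]
      by (intro has_vector_derivative_of_real) (auto simp: has_real_derivative_iff_has_vector_derivative has_vector_derivative_at_within)
    moreover have "(?E has_vector_derivative \<mu> * ?E x) (at x within {0..1})"
      by (rule has_vector_derivative_real_field) (auto intro!: derivative_eq_intros)
    ultimately show "((\<lambda>x. ?E x * ?\<phi> x) has_vector_derivative \<mu> * ?E x * ?\<phi> x + ?E x * ?d x) (at x within {0..1})"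
      by (rule has_vector_derivative_eq_rhs[OF has_vector_derivative_mult[rotated]]) simp
    show "continuous_on {0..1} (\<lambda>x. \<mu> * ?E x * ?\<phi> x + ?E x * ?d x)"
      by (intro continuous_intros cont)
  qed
  also have "\<dots> = - (LINT x|Omega. h x * (?E x * ?\<phi> x))"
    using test_function_endpoints[OF \<phi>] by simp
  finally have *: "(LINT x|Omega. ?W x * (\<mu> * ?E x * ?\<phi> x + ?E x * ?d x)) = - (LINT x|Omega. h x * (?E x * ?\<phi> x))" .
  have i1: "integrable Omega (\<lambda>x. ?W x * (\<mu> * ?E x * ?\<phi> x))"
    and i2: "integrable Omega (\<lambda>x. ?W x * (?E x * ?d x))"
    by (intro continuous_on_integrable_Omega continuous_intros cont continuous_on_primitive int)+
  have i3: "integrable Omega (\<lambda>x. h x * (?E x * ?\<phi> x))"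
    by (intro L2_integrable_mult h continuous_on_L2_Omega continuous_intros cont)
  have "(LINT x|Omega. ?E x * ?W x * ?d x) = (LINT x|Omega. ?W x * (\<mu> * ?E x * ?\<phi> x + ?E x * ?d x))
      - (LINT x|Omega. ?W x * (\<mu> * ?E x * ?\<phi> x))"
    using i1 i2 by (simp add: distrib_left ac_simps)
  also have "\<dots> = - (LINT x|Omega. h x * (?E x * ?\<phi> x) + ?W x * (\<mu> * ?E x * ?\<phi> x))"
    unfolding * using i1 i3 by simp
  also have "(\<lambda>x. h x * (?E x * ?\<phi> x) + ?W x * (\<mu> * ?E x * ?\<phi> x)) = (\<lambda>x. ?E x * (\<mu> * ?W x + h x) * ?\<phi> x)"
    by (simp add: fun_eq_iff algebra_simps)
  finally show "(LINT x|Omega. ?E x * ?W x * ?d x) = - (LINT x|Omega. ?E x * (\<mu> * ?W x + h x) * ?\<phi> x)" .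
qed

text \<open>The difference of \<open>u\<close> and the primitive of \<open>g\<close> has weak derivative 0.\<close>

lemma weak_derivative_imp_primitive:
  assumes "weak_derivative u g" "u \<in> L2 Omega" "g \<in> L2 Omega"
  shows "\<exists>c. AE x in Omega. u x = c + primitive g x"
proof -
  note int = L2_Omega_integrable[OF assms(3)]
  have L2p: "primitive g \<in> L2 Omega"
    by (intro continuous_on_L2_Omega continuous_on_primitive int)
  have p: "weak_derivative (primitive g) g"
    using weak_derivative_exp_mult[OF assms(3), of 0 0] by simp
  have "\<exists>c. AE x in Omega. u x - primitive g x = c"
  proof (rule du_Bois_Reymond)
    show "integrable Omega (\<lambda>x. u x - primitive g x)"
      by (intro L2_Omega_integrable L2_diff assms L2p)
    fix \<phi> assume "test_function \<phi>"
    then show "(LINT x|Omega. (u x - primitive g x) * complex_of_real (deriv \<phi> x)) = 0"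
      using weak_derivative_diff[OF assms(1) p assms(2,3) L2p assms(3)]
      by (simp add: weak_derivative_def)
  qed
  then show ?thesis by (auto simp: diff_eq_eq add.commute)
qed

text \<open>In one dimension every square integrable function is a gradient, namely that of its primitive.\<close>

lemma grad_H1_eq_L2_Omega: "grad_H1 = L2 Omega"
proof -
  have "g \<in> grad_H1" if g: "g \<in> L2 Omega" for g
  proof -
    have "weak_derivative (primitive g) g"
      using weak_derivative_exp_mult[OF g, of 0 0] by simp
    moreover have "primitive g \<in> L2 Omega"
      by (intro continuous_on_L2_Omega continuous_on_primitive L2_Omega_integrable g)
    ultimately show ?thesis using g by (auto simp: grad_H1_def H1_def)
  qed
  then show ?thesis by (auto simp: grad_H1_def)
qed

lemma wderiv_spec:
  assumes "u \<in> H1"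
  shows "wderiv u \<in> L2 Omega" "weak_derivative u (wderiv u)"
proof -
  have "\<exists>g. g \<in> L2 Omega \<and> weak_derivative u g" using assms by (auto simp: H1_def)
  from someI_ex[OF this] show "wderiv u \<in> L2 Omega" "weak_derivative u (wderiv u)"
    by (auto simp: wderiv_def)
qed

lemma H1_I: "u \<in> L2 Omega \<Longrightarrow> g \<in> L2 Omega \<Longrightarrow> weak_derivative u g \<Longrightarrow> u \<in> H1"
  by (auto simp: H1_def)

lemma H1_L2: "u \<in> H1 \<Longrightarrow> u \<in> L2 Omega"
  by (auto simp: H1_def)

lemma wderiv_AE:
  assumes "u \<in> L2 Omega" "g \<in> L2 Omega" "weak_derivative u g"
  shows "AE x in Omega. wderiv u x = g x"
  using weak_derivative_unique[OF wderiv_spec(2) assms(3) wderiv_spec(1) assms(2)] H1_I[OF assms] by blast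

section \<open>Traces\<close>

text \<open>The set of points of the open interval where the functions differ is open and null, hence empty; the end
  points follow by continuity.\<close>

lemma continuous_AE_eq_imp_eq:
  fixes f g :: "real \<Rightarrow> complex"
  assumes f: "continuous_on {0..1} f" and g: "continuous_on {0..1} g"
    and eq: "AE x in Omega. f x = g x" and x: "x \<in> {0..1}"
  shows "f x = g x"
proof -
  let ?d = "\<lambda>x. f x - g x"
  have d: "continuous_on {0..1} ?d" by (intro continuous_intros f g)
  have "?d y = 0" if y: "y \<in> {0<..<1}" for y
  proof (rule ccontr)
    assume nz: "?d y \<noteq> 0"
    define S where "S = {0<..<1} \<inter> ?d -` (- {0})"
    have "open S"
      unfolding S_def
      by (intro continuous_open_preimage continuous_on_subset[OF d]) auto
    moreover have "y \<in> S" using y nz by (simp add: S_def)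
    ultimately have "\<not> negligible S" by (intro open_not_negligible) auto
    moreover have "AE x in lborel. x \<notin> S"
      using eq unfolding AE_Omega by eventually_elim (auto simp: S_def)
    then have "S \<in> null_sets lborel"
      using \<open>open S\<close> by (subst AE_iff_null_sets) auto
    then have "negligible S"
      using null_sets_completionI negligible_iff_null_sets by blast
    ultimately show False by simp
  qed
  moreover have "closure {0<..<1::real} = {0..1}" by simp
  ultimately have "?d x = 0"
    using continuous_constant_on_closure[of "{0<..<1::real}" ?d 0 x] d x by simp
  then show ?thesis by simp
qed

lemma boundary_trace_eq:
  assumes "continuous_on {0..1} w" "AE t in Omega. w t = u t" "x \<in> {0..1}"
  shows "boundary_trace u x = w x"
  unfolding boundary_trace_def
proof (rule the_equality)
  show "\<exists>w'. continuous_on {0..1} w' \<and> (AE t in Omega. w' t = u t) \<and> w x = w' x"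
    using assms by blast
  fix y assume "\<exists>w'. continuous_on {0..1} w' \<and> (AE t in Omega. w' t = u t) \<and> y = w' x"
  then obtain w' where w': "continuous_on {0..1} w'" "AE t in Omega. w' t = u t" "y = w' x" by blast
  have "AE t in Omega. w' t = w t" using w'(2) assms(2) by eventually_elim simp
  from continuous_AE_eq_imp_eq[OF w'(1) assms(1) this assms(3)] w'(3) show "y = w x" by simp
qed

section \<open>Weak solutions of scalar transport equations\<close>

text \<open>The solution of \<open>u' = \<mu> u + G\<close> with \<open>u 0 = c\<close>.\<close>

definition duhamel :: "complex \<Rightarrow> complex \<Rightarrow> (real \<Rightarrow> complex) \<Rightarrow> real \<Rightarrow> complex" where
  "duhamel \<mu> c G x =
     exp (\<mu> * complex_of_real x) * (c + primitive (\<lambda>y. exp (- \<mu> * complex_of_real y) * G y) x)"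

lemma L2_exp_mult:
  "G \<in> L2 Omega \<Longrightarrow> (\<lambda>y. exp (\<mu> * complex_of_real y) * G y) \<in> L2 Omega"
  by (rule L2_Omega_mult_continuous) (auto intro!: continuous_intros)

lemma continuous_on_duhamel:
  assumes "G \<in> L2 Omega"
  shows "continuous_on A (duhamel \<mu> c G)"
  unfolding duhamel_def
  by (intro continuous_intros continuous_on_primitive L2_Omega_integrable L2_exp_mult assms)

lemma weak_derivative_duhamel:
  assumes G: "G \<in> L2 Omega"
  shows "weak_derivative (duhamel \<mu> c G) (\<lambda>x. \<mu> * duhamel \<mu> c G x + G x)"
proof -
  have "exp (\<mu> * complex_of_real x) * (exp (- \<mu> * complex_of_real x) * G x) = G x" for x
    by (simp add: mult.assoc[symmetric] exp_add[symmetric])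
  then have "(\<lambda>x. exp (\<mu> * complex_of_real x) * (\<mu> * (c + primitive (\<lambda>y. exp (- \<mu> * complex_of_real y) * G y) x)
      + exp (- \<mu> * complex_of_real x) * G x)) = (\<lambda>x. \<mu> * duhamel \<mu> c G x + G x)"
    unfolding duhamel_def by (simp only: distrib_left[of "exp _"] mult.left_commute[of "exp _" \<mu>])
  then show ?thesis
    using weak_derivative_exp_mult[OF L2_exp_mult[OF G], of \<mu> c "- \<mu>"]
    by (simp only: duhamel_def[abs_def])
qed

lemma duhamel_0 [simp]: "duhamel \<mu> c G 0 = c"
  by (simp add: duhamel_def)

lemma norm_duhamel_le:
  assumes G: "G \<in> L2 Omega" and "Re \<mu> = 0"
  shows "cmod (duhamel \<mu> c G x) \<le> cmod c + (LINT y|Omega. cmod (G y))"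
proof -
  have "cmod (primitive (\<lambda>y. exp (- \<mu> * complex_of_real y) * G y) x)
      \<le> (LINT y|Omega. cmod (exp (- \<mu> * complex_of_real y) * G y))"
    by (intro norm_primitive_le L2_Omega_integrable L2_exp_mult G)
  also have "\<dots> = (LINT y|Omega. cmod (G y))"
    by (simp add: norm_mult assms)
  finally show ?thesis
    using norm_triangle_ineq[of c "primitive (\<lambda>y. exp (- \<mu> * complex_of_real y) * G y) x"]
    by (simp add: duhamel_def norm_mult assms)
qed

text \<open>The integrating factor \<open>exp (-\<mu> x)\<close> turns the equation into a weak derivative that is known explicitly. The
  product rule applies after \<open>u\<close> has been replaced by its absolutely continuous representative.\<close>

lemma weak_ODE_solution:
  assumes u: "u \<in> L2 Omega" and g: "g \<in> L2 Omega" and ug: "weak_derivative u g" and G: "G \<in> L2 Omega"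
    and eq: "AE x in Omega. g x = \<mu> * u x + G x"
  shows "\<exists>c. AE x in Omega. duhamel \<mu> c G x = u x"
proof -
  let ?E = "\<lambda>x. exp (- \<mu> * complex_of_real x)"
  obtain c where c: "AE x in Omega. u x = c + primitive g x"
    using weak_derivative_imp_primitive[OF ug u g] by blast
  let ?Z = "\<lambda>x. ?E x * (c + primitive g x)"
  have Z: "weak_derivative ?Z (\<lambda>x. ?E x * (- \<mu> * (c + primitive g x) + g x))"
    using weak_derivative_exp_mult[OF g, of "- \<mu>" c] .
  have L2_W: "(\<lambda>x. c + primitive g x) \<in> L2 Omega"
    by (intro continuous_on_L2_Omega continuous_intros continuous_on_primitive L2_Omega_integrable g)
  have Z_L2: "?Z \<in> L2 Omega" by (intro L2_exp_mult L2_W)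
  have L2': "(\<lambda>x. ?E x * (- \<mu> * (c + primitive g x) + g x)) \<in> L2 Omega"
    by (intro L2_exp_mult L2_add L2_scale L2_W g)
  have "AE x in Omega. ?E x * (- \<mu> * (c + primitive g x) + g x) = ?E x * G x"
    using c eq by eventually_elim simp
  then have "weak_derivative ?Z (\<lambda>x. ?E x * G x)"
    by (intro weak_derivative_cong_AE[OF Z L2_measurable[OF Z_L2] L2_measurable[OF Z_L2] _
          L2_measurable[OF L2'] L2_measurable[OF L2_exp_mult[OF G]]]) auto
  then obtain c' where c': "AE x in Omega. ?Z x = c' + primitive (\<lambda>x. ?E x * G x) x"
    using weak_derivative_imp_primitive[OF _ Z_L2 L2_exp_mult[OF G]] by blast
  have "AE x in Omega. duhamel \<mu> c' G x = u x"
    using c c'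
  proof eventually_elim
    case (elim x)
    have "duhamel \<mu> c' G x = exp (\<mu> * complex_of_real x) * (?E x * (c + primitive g x))"
      unfolding duhamel_def using elim(2) by simp
    also have "\<dots> = u x"
      using elim(1) by (simp add: mult.assoc[symmetric] exp_add[symmetric])
    finally show ?case .
  qed
  then show ?thesis by blast
qed

section \<open>The relaxation measure and its Stieltjes transform\<close>

lemma nn_integral_exp_decay:
  fixes \<tau> :: real
  assumes "0 < \<tau>"
  shows "(\<integral>\<^sup>+t. ennreal (exp (- \<tau> * t)) * indicator {0<..} t \<partial>lborel) = ennreal (1 / \<tau>)"
proof -
  have "(\<integral>\<^sup>+t. ennreal (exp (- \<tau> * t)) * indicator {0<..} t \<partial>lborel) =
      (\<integral>\<^sup>+t. ennreal (exp (- \<tau> * t)) * indicator {0..} t \<partial>lborel)"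
    by (rule nn_integral_cong_AE)
       (use AE_lborel_singleton[of 0] in \<open>auto elim!: eventually_mono simp: indicator_def\<close>)
  also have "\<dots> = ennreal (0 - (- exp (- \<tau> * 0) / \<tau>))"
  proof (rule nn_integral_FTC_atLeast)
    show "((\<lambda>t. - exp (- \<tau> * t) / \<tau>) has_real_derivative exp (- \<tau> * t)) (at t)" for t
      using assms by (auto intro!: derivative_eq_intros)
    have "filterlim (\<lambda>t. \<tau> * t) at_top at_top"
      using assms by (intro filterlim_tendsto_pos_mult_at_top[OF tendsto_const _ filterlim_ident])
    then have "((\<lambda>t. exp (- (\<tau> * t))) \<longlongrightarrow> 0) at_top"
      by (intro filterlim_compose[OF exp_at_bot] filterlim_compose[OF filterlim_uminus_at_bot_at_top])
    from tendsto_divide[OF tendsto_minus[OF this] tendsto_const, of \<tau>]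
    show "((\<lambda>t. - exp (- \<tau> * t) / \<tau>) \<longlongrightarrow> 0) at_top"
      using assms by simp
  qed auto
  finally show ?thesis by simp
qed

text \<open>All that the resolvent bounds use of the kernel: the relaxation rates are positive, \<open>\<tau>\<^sup>-\<^sup>1\<close> is
  integrable, and the measure is not zero.\<close>

locale relaxation_measure =
  fixes \<nu> :: "real measure"
  assumes sets_nu [measurable_cong]: "sets \<nu> = sets borel"
    and AE_pos: "AE \<tau> in \<nu>. 0 < \<tau>"
    and integrable_inverse: "integrable \<nu> (\<lambda>\<tau>. 1 / \<tau>)"
    and nontrivial: "emeasure \<nu> (space \<nu>) \<noteq> 0"

text \<open>By Tonelli, \<open>\<integral> k(t) dt = \<integral> (\<integral> exp (-\<tau> t) dt) d\<nu>(\<tau>)\<close>. The inner integral is \<open>\<tau>\<^sup>-\<^sup>1\<close> for \<open>\<tau> > 0\<close> and infinite for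
  \<open>\<tau> = 0\<close>, so finiteness yields both integrability of \<open>\<tau>\<^sup>-\<^sup>1\<close> and the absence of mass at 0.\<close>

lemma relaxation_measure_of_integrable_kernel:
  fixes k :: "real \<Rightarrow> real" and \<nu> :: "real measure"
  assumes borel: "sets \<nu> = sets borel"
    and radon: "\<And>K. compact K \<Longrightarrow> emeasure \<nu> K < \<infinity>"
    and carrier: "emeasure \<nu> {..<0} = 0"
    and laplace: "\<And>t. 0 < t \<Longrightarrow> integrable \<nu> (\<lambda>\<tau>. exp (- \<tau> * t))"
      "\<And>t. 0 < t \<Longrightarrow> k t = (LINT \<tau>|\<nu>. exp (- \<tau> * t))"
    and k_integrable: "set_integrable lborel {0<..} k"
    and k_nonzero: "\<exists>t>0. k t \<noteq> 0"
  shows "relaxation_measure \<nu>"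
proof -
  note [measurable_cong] = borel
  have space: "space \<nu> = UNIV" using sets_eq_imp_space_eq[OF borel] by simp
  interpret \<nu>: sigma_finite_measure \<nu>
  proof
    let ?A = "range (\<lambda>n::nat. {- real n..real n})"
    have "\<exists>n::nat. x \<in> {- real n..real n}" for x :: real
      using real_arch_simple[of "\<bar>x\<bar>"] by (meson abs_le_iff minus_le_iff atLeastAtMost_iff)
    then have "\<Union> ?A = space \<nu>" by (auto simp: space)
    moreover have "emeasure \<nu> a \<noteq> \<infinity>" if "a \<in> ?A" for a
      using that radon[of a] by auto
    ultimately show "\<exists>A. countable A \<and> A \<subseteq> sets \<nu> \<and> \<Union> A = space \<nu> \<and> (\<forall>a\<in>A. emeasure \<nu> a \<noteq> \<infinity>)"
      by (intro exI[of _ ?A]) (auto simp: borel)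
  qed
  interpret P: pair_sigma_finite lborel \<nu>
    by (intro pair_sigma_finite.intro lborel.sigma_finite_measure_axioms \<nu>.sigma_finite_measure_axioms)
  have nonneg: "AE \<tau> in \<nu>. 0 \<le> \<tau>"
    by (rule AE_I[of _ _ "{..<0}"]) (auto simp: carrier borel)
  define J where "J \<tau> = (\<integral>\<^sup>+t. ennreal (exp (- \<tau> * t)) * indicator {0<..} t \<partial>lborel)" for \<tau> :: real
  have J_meas [measurable]: "J \<in> borel_measurable \<nu>"
    unfolding J_def by measurable
  have "(\<integral>\<^sup>+\<tau>. J \<tau> \<partial>\<nu>) = (\<integral>\<^sup>+t. \<integral>\<^sup>+\<tau>. ennreal (exp (- \<tau> * t)) * indicator {0<..} t \<partial>\<nu> \<partial>lborel)"
    unfolding J_def by (rule P.Fubini') measurable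
  also have "\<dots> = (\<integral>\<^sup>+t. ennreal (norm (indicator {0<..} t *\<^sub>R k t)) \<partial>lborel)"
  proof (rule nn_integral_cong)
    fix t :: real
    show "(\<integral>\<^sup>+\<tau>. ennreal (exp (- \<tau> * t)) * indicator {0<..} t \<partial>\<nu>) = ennreal (norm (indicator {0<..} t *\<^sub>R k t))"
    proof (cases "0 < t")
      case True
      have "0 \<le> k t" unfolding laplace(2)[OF True] by simp
      then show ?thesis
        using True nn_integral_eq_integral[OF laplace(1)[OF True]] by (simp add: laplace(2)[OF True])
    qed simp
  qed
  also have "\<dots> < \<infinity>"
    using k_integrable unfolding set_integrable_def integrable_iff_bounded by simp
  finally have J_fin: "(\<integral>\<^sup>+\<tau>. J \<tau> \<partial>\<nu>) < \<infinity>" .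
  have fin: "AE \<tau> in \<nu>. J \<tau> \<noteq> \<infinity>"
    by (rule nn_integral_PInf_AE) (use J_fin in auto)
  have J0: "J 0 = \<infinity>"
  proof -
    have "ennreal (real n) \<le> J 0" for n
    proof -
      have "ennreal (real n) = emeasure lborel {0<..<real n}" by simp
      also have "\<dots> \<le> emeasure lborel {0::real<..}" by (rule emeasure_mono) auto
      also have "\<dots> = J 0" by (simp add: J_def)
      finally show ?thesis .
    qed
    then show ?thesis
      by (metis ennreal_Ex_less_of_nat ennreal_of_nat_eq_real_of_nat infinity_ennreal_def leD top.not_eq_extremum)
  qed
  have pos: "AE \<tau> in \<nu>. 0 < \<tau>"
    using fin nonneg by eventually_elim (use J0 in \<open>auto simp: less_le\<close>)
  have "integrable \<nu> (\<lambda>\<tau>. 1 / \<tau>)"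
  proof (rule integrableI_bounded)
    have "(\<integral>\<^sup>+\<tau>. ennreal (norm (1 / \<tau>)) \<partial>\<nu>) = (\<integral>\<^sup>+\<tau>. J \<tau> \<partial>\<nu>)"
      by (rule nn_integral_cong_AE)
         (use pos in \<open>eventually_elim, unfold J_def, subst nn_integral_exp_decay, auto\<close>)
    with J_fin show "(\<integral>\<^sup>+\<tau>. ennreal (norm (1 / \<tau>)) \<partial>\<nu>) < \<infinity>" by simp
  qed measurable
  moreover have "emeasure \<nu> (space \<nu>) \<noteq> 0"
  proof
    assume "emeasure \<nu> (space \<nu>) = 0"
    then have "AE \<tau> in \<nu>. exp (- \<tau> * t) = 0" for t
      by (intro AE_I[of _ _ "space \<nu>"]) auto
    then have "k t = 0" if "0 < t" for t
      unfolding laplace(2)[OF that] by (rule integral_eq_zero_AE)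
    with k_nonzero show False by blast
  qed
  ultimately show ?thesis using borel pos by unfold_locales
qed

context relaxation_measure
begin

lemma AE_I_pos: "(\<And>\<tau>. 0 < \<tau> \<Longrightarrow> P \<tau>) \<Longrightarrow> AE \<tau> in \<nu>. P \<tau>"
  using AE_pos by (auto elim!: eventually_mono)

abbreviation resolvent_kernel :: "real \<Rightarrow> real \<Rightarrow> complex" where
  "resolvent_kernel \<sigma> \<tau> \<equiv> 1 / (\<i> * complex_of_real \<sigma> + complex_of_real \<tau>)"

abbreviation \<kappa> :: "real \<Rightarrow> complex" where
  "\<kappa> \<sigma> \<equiv> khat \<nu> (\<i> * complex_of_real \<sigma>)"

text \<open>This is the integral of the kernel over the half-line; it bounds the impedance \<open>\<kappa>\<close> uniformly in \<open>\<sigma>\<close>.\<close>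

definition K :: real where "K = (LINT \<tau>|\<nu>. 1 / \<tau>)"

lemma shifted_rate_nonzero: "0 < \<tau> \<Longrightarrow> \<i> * complex_of_real \<sigma> + complex_of_real \<tau> \<noteq> 0"
  by (auto simp: complex_eq_iff)

lemma norm_resolvent_kernel_sq: "(cmod (resolvent_kernel \<sigma> \<tau>))\<^sup>2 = 1 / (\<sigma>\<^sup>2 + \<tau>\<^sup>2)"
  by (simp add: norm_divide power_divide cmod_power2 add.commute)

lemma norm_resolvent_kernel_le:
  assumes "0 < \<tau>"
  shows "cmod (resolvent_kernel \<sigma> \<tau>) \<le> 1 / \<tau>"
proof -
  have "\<tau> \<le> cmod (\<i> * complex_of_real \<sigma> + complex_of_real \<tau>)"
    using complex_Re_le_cmod[of "\<i> * complex_of_real \<sigma> + complex_of_real \<tau>"] by simp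
  with assms show ?thesis by (simp add: norm_divide divide_simps)
qed

lemma integrable_resolvent_kernel: "integrable \<nu> (resolvent_kernel \<sigma>)"
proof (rule Bochner_Integration.integrable_bound[OF integrable_inverse])
  show "AE \<tau> in \<nu>. norm (resolvent_kernel \<sigma> \<tau>) \<le> norm (1 / \<tau>)"
    using AE_pos by eventually_elim (use norm_resolvent_kernel_le in auto)
qed measurable

lemma K_nonneg: "0 \<le> K"
  unfolding K_def by (rule integral_nonneg_AE) (use AE_pos in \<open>auto elim!: eventually_mono\<close>)

lemma norm_khat_le: "cmod (\<kappa> \<sigma>) \<le> K"
proof -
  have "cmod (\<kappa> \<sigma>) \<le> (LINT \<tau>|\<nu>. cmod (resolvent_kernel \<sigma> \<tau>))"
    unfolding khat_def by (rule integral_norm_bound)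
  also have "\<dots> \<le> K"
    unfolding K_def
    by (intro integral_mono_AE integrable_norm integrable_resolvent_kernel integrable_inverse)
       (rule AE_I_pos, rule norm_resolvent_kernel_le)
  finally show ?thesis .
qed

lemma inverse_sum_squares_le:
  fixes \<tau> \<sigma> :: real
  assumes "1 \<le> \<bar>\<sigma>\<bar>" "0 < \<tau>"
  shows "1 / (\<sigma>\<^sup>2 + \<tau>\<^sup>2) \<le> 1 / \<tau>"
proof -
  have "1 \<le> \<sigma>\<^sup>2" using assms(1) by (metis one_le_power power2_abs)
  moreover have "2 * 1 * \<tau> \<le> 1\<^sup>2 + \<tau>\<^sup>2" by (rule sum_squares_bound)
  ultimately have "\<tau> \<le> \<sigma>\<^sup>2 + \<tau>\<^sup>2" using assms by simp
  then show ?thesis using assms by (intro divide_left_mono) auto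
qed

lemma resolvent_kernel_L2:
  assumes "1 \<le> \<bar>\<sigma>\<bar>"
  shows "resolvent_kernel \<sigma> \<in> L2 \<nu>" "(LINT \<tau>|\<nu>. (cmod (resolvent_kernel \<sigma> \<tau>))\<^sup>2) \<le> K"
proof -
  have int: "integrable \<nu> (\<lambda>\<tau>. 1 / (\<sigma>\<^sup>2 + \<tau>\<^sup>2))"
  proof (rule Bochner_Integration.integrable_bound[OF integrable_inverse])
    show "AE \<tau> in \<nu>. norm (1 / (\<sigma>\<^sup>2 + \<tau>\<^sup>2)) \<le> norm (1 / \<tau>)"
      using AE_pos by eventually_elim (use inverse_sum_squares_le[OF assms] in auto)
  qed measurable
  then show "resolvent_kernel \<sigma> \<in> L2 \<nu>"
    unfolding L2_def mem_Collect_eq norm_resolvent_kernel_sq by simp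
  show "(LINT \<tau>|\<nu>. (cmod (resolvent_kernel \<sigma> \<tau>))\<^sup>2) \<le> K"
    unfolding norm_resolvent_kernel_sq K_def
    by (intro integral_mono_AE int integrable_inverse)
       (rule AE_I_pos, rule inverse_sum_squares_le[OF assms])
qed

lemma Re_resolvent_kernel: "Re (resolvent_kernel \<sigma> \<tau>) = \<tau> / (\<sigma>\<^sup>2 + \<tau>\<^sup>2)"
  and Im_resolvent_kernel: "Im (resolvent_kernel \<sigma> \<tau>) = - \<sigma> / (\<sigma>\<^sup>2 + \<tau>\<^sup>2)"
  by (simp_all add: Re_divide Im_divide add.commute)

lemma integrable_Re_resolvent_kernel: "integrable \<nu> (\<lambda>\<tau>. \<tau> / (\<sigma>\<^sup>2 + \<tau>\<^sup>2))"
  using integrable_Re[OF integrable_resolvent_kernel[of \<sigma>]] by (simp only: Re_resolvent_kernel)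

lemma Re_khat: "Re (\<kappa> \<sigma>) = (LINT \<tau>|\<nu>. \<tau> / (\<sigma>\<^sup>2 + \<tau>\<^sup>2))"
  unfolding khat_def integral_Re[OF integrable_resolvent_kernel, symmetric] Re_resolvent_kernel ..

lemma Im_khat: "Im (\<kappa> \<sigma>) = (LINT \<tau>|\<nu>. - \<sigma> / (\<sigma>\<^sup>2 + \<tau>\<^sup>2))"
  unfolding khat_def integral_Im[OF integrable_resolvent_kernel, symmetric] Im_resolvent_kernel ..

lemma integral_pos_of_pos:
  fixes f :: "real \<Rightarrow> real"
  assumes f: "integrable \<nu> f" and "\<And>\<tau>. 0 < \<tau> \<Longrightarrow> 0 < f \<tau>"
  shows "0 < (LINT \<tau>|\<nu>. f \<tau>)"
proof -
  have pos: "AE \<tau> in \<nu>. 0 < f \<tau>"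
    by (intro AE_I_pos assms(2))
  then have nn: "AE \<tau> in \<nu>. 0 \<le> f \<tau>" by (auto elim!: eventually_mono)
  have "(LINT \<tau>|\<nu>. f \<tau>) \<noteq> 0"
  proof
    assume "(LINT \<tau>|\<nu>. f \<tau>) = 0"
    then have "AE \<tau> in \<nu>. f \<tau> = 0"
      using integral_nonneg_eq_0_iff_AE[OF f nn] by simp
    with pos have "AE \<tau> in \<nu>. False" by eventually_elim simp
    then show False
      using nontrivial by (simp add: AE_iff_measurable[OF _ refl])
  qed
  with integral_nonneg_AE[OF nn] show ?thesis by simp
qed

lemma Re_khat_pos: "0 < Re (\<kappa> \<sigma>)"
  unfolding Re_khat by (intro integral_pos_of_pos integrable_Re_resolvent_kernel) (auto intro!: divide_pos_pos add_nonneg_pos)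

text \<open>In particular \<open>\<kappa> \<noteq> 1\<close>, so that \<open>(1 + \<kappa>) / (1 - \<kappa>)\<close> has a logarithm.\<close>

lemma Im_khat_neg:
  assumes "0 < \<sigma>"
  shows "Im (\<kappa> \<sigma>) < 0"
proof -
  have "integrable \<nu> (\<lambda>\<tau>. - \<sigma> / (\<sigma>\<^sup>2 + \<tau>\<^sup>2))"
    using integrable_Im[OF integrable_resolvent_kernel[of \<sigma>]] by (simp only: Im_resolvent_kernel)
  then have "integrable \<nu> (\<lambda>\<tau>. - (- \<sigma> / (\<sigma>\<^sup>2 + \<tau>\<^sup>2)))" by (rule integrable_minus)
  then have "0 < (LINT \<tau>|\<nu>. - (- \<sigma> / (\<sigma>\<^sup>2 + \<tau>\<^sup>2)))"
    using assms by (intro integral_pos_of_pos) (auto intro!: divide_pos_pos add_pos_nonneg)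
  then show ?thesis unfolding Im_khat by simp
qed

lemma Re_khat_antimono:
  assumes "\<bar>\<sigma>\<bar> \<le> \<bar>s\<bar>"
  shows "Re (\<kappa> s) \<le> Re (\<kappa> \<sigma>)"
  unfolding Re_khat
proof (intro integral_mono_AE integrable_Re_resolvent_kernel)
  have "\<sigma>\<^sup>2 \<le> s\<^sup>2" using assms by (simp add: abs_le_square_iff)
  then show "AE \<tau> in \<nu>. \<tau> / (s\<^sup>2 + \<tau>\<^sup>2) \<le> \<tau> / (\<sigma>\<^sup>2 + \<tau>\<^sup>2)"
    using AE_pos
    by (auto elim!: eventually_mono intro!: divide_left_mono mult_pos_pos add_nonneg_pos)
qed

text \<open>For \<open>\<bar>s\<bar> \<le> 2 \<bar>\<sigma>\<bar>\<close> one has \<open>s\<^sup>2 + \<tau>\<^sup>2 \<le> 4 (\<sigma>\<^sup>2 + \<tau>\<^sup>2)\<close>. A resonance therefore serves all frequencies up to twice its own.\<close>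

lemma Re_khat_doubling:
  assumes "\<bar>s\<bar> \<le> 2 * \<bar>\<sigma>\<bar>"
  shows "Re (\<kappa> \<sigma>) \<le> 4 * Re (\<kappa> s)"
proof -
  have s: "s\<^sup>2 \<le> 4 * \<sigma>\<^sup>2"
    using power_mono[OF assms, of 2] by (simp add: power_mult_distrib)
  have "Re (\<kappa> \<sigma>) \<le> (LINT \<tau>|\<nu>. 4 * (\<tau> / (s\<^sup>2 + \<tau>\<^sup>2)))"
    unfolding Re_khat
  proof (intro integral_mono_AE integrable_Re_resolvent_kernel integrable_mult_right)
    show "AE \<tau> in \<nu>. \<tau> / (\<sigma>\<^sup>2 + \<tau>\<^sup>2) \<le> 4 * (\<tau> / (s\<^sup>2 + \<tau>\<^sup>2))"
      using AE_pos
    proof eventually_elim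
      case (elim \<tau>)
      have "0 < \<sigma>\<^sup>2 + \<tau>\<^sup>2" "0 < s\<^sup>2 + \<tau>\<^sup>2" using elim by (auto intro!: add_nonneg_pos)
      moreover have "s\<^sup>2 + \<tau>\<^sup>2 \<le> 4 * (\<sigma>\<^sup>2 + \<tau>\<^sup>2)"
        unfolding distrib_left by (intro add_mono s) simp
      then have "\<tau> * (s\<^sup>2 + \<tau>\<^sup>2) \<le> \<tau> * (4 * (\<sigma>\<^sup>2 + \<tau>\<^sup>2))"
        using elim by (intro mult_left_mono) auto
      ultimately show ?case by (simp add: field_simps)
    qed
  qed
  then show ?thesis by (simp only: Re_khat integral_mult_right_zero)
qed

lemma continuous_khat: "continuous_on A \<kappa>"
proof (intro continuous_at_imp_continuous_on ballI)
  fix \<sigma>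
  show "isCont \<kappa> \<sigma>"
    unfolding continuous_at_sequentially comp_def khat_def
  proof (intro allI impI integral_dominated_convergence[where w = "\<lambda>\<tau>. 1 / \<tau>"] integrable_inverse)
    fix X assume X: "X \<longlonglongrightarrow> \<sigma>"
    show "AE \<tau> in \<nu>. (\<lambda>n. resolvent_kernel (X n) \<tau>) \<longlonglongrightarrow> resolvent_kernel \<sigma> \<tau>"
      by (intro AE_I_pos tendsto_intros X shifted_rate_nonzero)
    show "AE \<tau> in \<nu>. norm (resolvent_kernel (X n) \<tau>) \<le> 1 / \<tau>" for n
      by (intro AE_I_pos norm_resolvent_kernel_le)
  qed measurable
qed

lemma khat_tendsto_0: "(\<kappa> \<longlongrightarrow> 0) at_top"
proof -
  have "((\<lambda>\<sigma>. LINT \<tau>|\<nu>. resolvent_kernel \<sigma> \<tau>) \<longlongrightarrow> (LINT \<tau>|\<nu>. 0)) at_top"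
  proof (rule integral_dominated_convergence_at_top[where w = "\<lambda>\<tau>. 1 / \<tau>"])
    show "AE \<tau> in \<nu>. ((\<lambda>\<sigma>. resolvent_kernel \<sigma> \<tau>) \<longlongrightarrow> 0) at_top"
    proof (rule AE_I2)
      fix \<tau>
      have "cmod (resolvent_kernel \<sigma> \<tau>) \<le> inverse \<sigma>" if "0 < \<sigma>" for \<sigma>
        using abs_Im_le_cmod[of "\<i> * complex_of_real \<sigma> + complex_of_real \<tau>"] that
        by (simp add: norm_divide divide_simps)
      then have "\<forall>\<^sub>F \<sigma> in at_top. cmod (resolvent_kernel \<sigma> \<tau>) \<le> inverse \<sigma>"
        by (auto intro: eventually_at_top_linorderI[of 1])
      then show "((\<lambda>\<sigma>. resolvent_kernel \<sigma> \<tau>) \<longlongrightarrow> 0) at_top"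
        by (rule Lim_null_comparison) (rule tendsto_inverse_0_at_top[OF filterlim_ident])
    qed
    show "\<forall>\<^sub>F \<sigma> in at_top. AE \<tau> in \<nu>. norm (resolvent_kernel \<sigma> \<tau>) \<le> 1 / \<tau>"
      by (intro always_eventually allI AE_I_pos norm_resolvent_kernel_le)
  qed (use integrable_inverse in auto)
  then show ?thesis by (simp add: khat_def)
qed

end

section \<open>The boundary system\<close>

text \<open>The reverse triangle inequality and \<open>\<bar>1 + \<kappa>\<bar>\<^sup>2 - \<bar>1 - \<kappa>\<bar>\<^sup>2 = 4 Re \<kappa>\<close>. The dissipation at the
  boundary keeps the system away from singularity.\<close>

lemma boundary_determinant:
  fixes \<kappa> z :: complex
  assumes z: "cmod z = 1" and \<kappa>: "0 < Re \<kappa>"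
  shows "4 * Re \<kappa> \<le> cmod ((1 - \<kappa>)\<^sup>2 * inverse z - (1 + \<kappa>)\<^sup>2 * z)"
proof -
  have "4 * Re \<kappa> = (cmod (1 + \<kappa>))\<^sup>2 - (cmod (1 - \<kappa>))\<^sup>2"
    unfolding cmod_power2 by (simp add: power2_eq_square algebra_simps)
  also have "\<dots> = cmod ((1 + \<kappa>)\<^sup>2 * z) - cmod ((1 - \<kappa>)\<^sup>2 * inverse z)"
    using z by (simp add: norm_mult norm_power norm_inverse)
  also have "\<dots> \<le> cmod ((1 - \<kappa>)\<^sup>2 * inverse z - (1 + \<kappa>)\<^sup>2 * z)"
    by (metis norm_minus_commute norm_triangle_ineq2)
  finally show ?thesis .
qed

text \<open>Here \<open>z = exp (i\<sigma>)\<close>, the unknowns are the values at 0 of the two Riemann invariants, and \<open>A\<close>, \<open>B\<close> are the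
  contributions of the data along the interval. The two equations are the impedance conditions at 0 and 1.\<close>

lemma boundary_system_solvable:
  fixes \<kappa> z H0 H1 A B :: complex
  assumes z: "cmod z = 1" and \<kappa>: "0 < Re \<kappa>"
  shows "\<exists>a b. (1 + \<kappa>) * a = (1 - \<kappa>) * b - 2 * H0 \<and>
    (1 - \<kappa>) * (inverse z * (a + A)) = (1 + \<kappa>) * (z * (b + B)) + 2 * H1"
proof -
  define D where "D = (1 - \<kappa>)\<^sup>2 * inverse z - (1 + \<kappa>)\<^sup>2 * z"
  define S where "S = 2 * H1 + (1 + \<kappa>) * z * B - (1 - \<kappa>) * inverse z * A"
  define a where "a = ((1 + \<kappa>) * z * (2 * H0) + (1 - \<kappa>) * S) / D"
  define b where "b = ((1 - \<kappa>) * inverse z * (2 * H0) + (1 + \<kappa>) * S) / D"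
  have D: "D \<noteq> 0" using boundary_determinant[OF assms] \<kappa> unfolding D_def by auto
  have aD: "a * D = (1 + \<kappa>) * z * (2 * H0) + (1 - \<kappa>) * S"
    and bD: "b * D = (1 - \<kappa>) * inverse z * (2 * H0) + (1 + \<kappa>) * S"
    using D by (simp_all add: a_def b_def)
  have "((1 + \<kappa>) * a - ((1 - \<kappa>) * b - 2 * H0)) * D
      = (1 + \<kappa>) * (a * D) - (1 - \<kappa>) * (b * D) + 2 * H0 * D"
    by (simp add: algebra_simps)
  also have "\<dots> = 0"
    unfolding aD bD unfolding D_def by (simp add: power2_eq_square algebra_simps)
  finally have 1: "(1 + \<kappa>) * a = (1 - \<kappa>) * b - 2 * H0" using D by simp
  have "((1 - \<kappa>) * (inverse z * (a + A)) - ((1 + \<kappa>) * (z * (b + B)) + 2 * H1)) * D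
      = (1 - \<kappa>) * inverse z * (a * D) - (1 + \<kappa>) * z * (b * D) - S * D"
    by (simp add: S_def algebra_simps)
  also have "\<dots> = 0"
    unfolding aD bD unfolding D_def by (simp add: power2_eq_square algebra_simps)
  finally have "(1 - \<kappa>) * (inverse z * (a + A)) = (1 + \<kappa>) * (z * (b + B)) + 2 * H1" using D by simp
  with 1 show ?thesis by blast
qed

text \<open>Cramer's rule, with all coefficients bounded by powers of \<open>1 + K\<close>.\<close>

lemma boundary_system_bound:
  fixes \<kappa> z H0 H1 A B a b :: complex
  assumes z: "cmod z = 1" and \<kappa>: "0 < Re \<kappa>" "cmod \<kappa> \<le> K"
    and eq0: "(1 + \<kappa>) * a = (1 - \<kappa>) * b - 2 * H0"
    and eq1: "(1 - \<kappa>) * (inverse z * (a + A)) = (1 + \<kappa>) * (z * (b + B)) + 2 * H1"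
    and H: "cmod H0 \<le> (1 + K) * e" "cmod H1 \<le> (1 + K) * e"
    and AB: "cmod A \<le> 2 * e" "cmod B \<le> 2 * e"
  shows "cmod a \<le> 2 * (1 + K)\<^sup>2 * e / Re \<kappa>" "cmod b \<le> 2 * (1 + K)\<^sup>2 * e / Re \<kappa>"
proof -
  define D where "D = (1 - \<kappa>)\<^sup>2 * inverse z - (1 + \<kappa>)\<^sup>2 * z"
  define S where "S = 2 * H1 + (1 + \<kappa>) * z * B - (1 - \<kappa>) * inverse z * A"
  have eq1': "(1 - \<kappa>) * inverse z * a - (1 + \<kappa>) * z * b = S"
    using eq1 by (simp add: S_def algebra_simps)
  have eq0': "(1 - \<kappa>) * b = (1 + \<kappa>) * a + 2 * H0" using eq0 by simp
  have "D * a = (1 - \<kappa>) * ((1 - \<kappa>) * inverse z * a - (1 + \<kappa>) * z * b)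
      + (1 + \<kappa>) * z * ((1 - \<kappa>) * b - (1 + \<kappa>) * a)"
    by (simp add: D_def power2_eq_square algebra_simps)
  then have aD: "D * a = (1 + \<kappa>) * z * (2 * H0) + (1 - \<kappa>) * S"
    unfolding eq1' eq0' by simp
  have "D * b = (1 + \<kappa>) * ((1 - \<kappa>) * inverse z * a - (1 + \<kappa>) * z * b)
      + (1 - \<kappa>) * inverse z * ((1 - \<kappa>) * b - (1 + \<kappa>) * a)"
    by (simp add: D_def power2_eq_square algebra_simps)
  then have bD: "D * b = (1 - \<kappa>) * inverse z * (2 * H0) + (1 + \<kappa>) * S"
    unfolding eq1' eq0' by simp
  have n1: "cmod (1 + \<kappa>) \<le> 1 + K" "cmod (1 - \<kappa>) \<le> 1 + K"
    using norm_triangle_ineq[of 1 \<kappa>] norm_triangle_ineq4[of 1 \<kappa>] \<kappa> by auto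
  have K: "0 \<le> 1 + K" using n1 norm_ge_zero order_trans by blast
  have e: "0 \<le> e" using AB(1) norm_ge_zero[of A] by linarith
  have prod: "cmod (x * y) \<le> X * Y" if "cmod x \<le> X" "cmod y \<le> Y" for x y X Y
    using that by (simp add: norm_mult mult_mono' )
  have nS: "cmod S \<le> 6 * ((1 + K) * e)"
  proof -
    have "cmod ((1 + \<kappa>) * (z * B)) \<le> (1 + K) * (2 * e)"
      using AB z by (intro prod[OF n1(1)]) (simp add: norm_mult)
    moreover have "cmod ((1 - \<kappa>) * (inverse z * A)) \<le> (1 + K) * (2 * e)"
      using AB z by (intro prod[OF n1(2)]) (simp add: norm_mult norm_inverse)
    moreover have "cmod (2 * H1) \<le> 2 * ((1 + K) * e)"
      using H by (simp add: norm_mult)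
    moreover have "cmod S \<le> cmod (2 * H1) + cmod ((1 + \<kappa>) * (z * B)) + cmod ((1 - \<kappa>) * (inverse z * A))"
      unfolding S_def mult.assoc by (meson norm_triangle_ineq4 norm_triangle_ineq add_right_mono order_trans)
    ultimately show ?thesis by simp
  qed
  have bound: "cmod w \<le> 2 * (1 + K)\<^sup>2 * e / Re \<kappa>"
    if w: "D * w = x * y * (2 * H0) + u * S" "cmod x \<le> 1 + K" "cmod y = 1" "cmod u \<le> 1 + K" for w x y u
  proof -
    have "4 * Re \<kappa> * cmod w \<le> cmod (D * w)"
      using boundary_determinant[OF z \<kappa>(1)] by (simp add: D_def norm_mult mult_right_mono)
    also have "\<dots> \<le> cmod (x * (y * (2 * H0))) + cmod (u * S)"
      unfolding w(1) using norm_triangle_ineq by (simp add: mult.assoc)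
    also have "\<dots> \<le> (1 + K) * (2 * ((1 + K) * e)) + (1 + K) * (6 * ((1 + K) * e))"
      using H w by (intro add_mono prod[OF w(2)] prod[OF w(4) nS]) (simp add: norm_mult)
    also have "\<dots> = 4 * (2 * (1 + K)\<^sup>2 * e)" by (simp add: power2_eq_square algebra_simps)
    finally show ?thesis using \<kappa> by (simp add: field_simps)
  qed
  show "cmod a \<le> 2 * (1 + K)\<^sup>2 * e / Re \<kappa>"
    using bound[OF aD] n1 z by simp
  show "cmod b \<le> 2 * (1 + K)\<^sup>2 * e / Re \<kappa>"
    using bound[OF bD] n1 z by (simp add: norm_inverse)
qed

section \<open>The energy norm\<close>

lemma L2_boundary_D: "\<psi> \<in> L2_boundary \<nu> \<Longrightarrow> x \<in> boundary \<Longrightarrow> (\<lambda>\<tau>. \<psi> \<tau> x) \<in> L2 \<nu>"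
  by (auto simp: L2_boundary_def)

lemma energy_norm_square:
  assumes "p \<in> L2 Omega" "v \<in> L2 Omega" "\<psi> \<in> L2_boundary \<nu>"
  shows "(energy_norm \<nu> (p, v, \<psi>))\<^sup>2 = (LINT x|Omega. (cmod (p x))\<^sup>2) + (LINT x|Omega. (cmod (v x))\<^sup>2)
    + (LINT \<tau>|\<nu>. (cmod (\<psi> \<tau> 0))\<^sup>2) + (LINT \<tau>|\<nu>. (cmod (\<psi> \<tau> 1))\<^sup>2)"
proof -
  have "0 \<le> (LINT x|Omega. ((cmod (p x))\<^sup>2 + (cmod (v x))\<^sup>2)) + (LINT \<tau>|\<nu>. (\<Sum>x\<in>boundary. (cmod (\<psi> \<tau> x))\<^sup>2))"
    by (intro add_nonneg_nonneg Bochner_Integration.integral_nonneg sum_nonneg) auto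
  then show ?thesis
    using L2_integrable_square[OF assms(1)] L2_integrable_square[OF assms(2)]
      L2_integrable_square[OF L2_boundary_D[OF assms(3)], of 0]
      L2_integrable_square[OF L2_boundary_D[OF assms(3)], of 1] by simp
qed

lemma energy_norm_nonneg: "0 \<le> energy_norm \<nu> U"
  by (cases U) (auto intro!: add_nonneg_nonneg Bochner_Integration.integral_nonneg sum_nonneg)

lemma energy_norm_components:
  assumes "p \<in> L2 Omega" "v \<in> L2 Omega" "\<psi> \<in> L2_boundary \<nu>"
  shows "(LINT x|Omega. (cmod (p x))\<^sup>2) \<le> (energy_norm \<nu> (p, v, \<psi>))\<^sup>2"
    and "(LINT x|Omega. (cmod (v x))\<^sup>2) \<le> (energy_norm \<nu> (p, v, \<psi>))\<^sup>2"
    and "x \<in> boundary \<Longrightarrow> (LINT \<tau>|\<nu>. (cmod (\<psi> \<tau> x))\<^sup>2) \<le> (energy_norm \<nu> (p, v, \<psi>))\<^sup>2"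
proof -
  have "0 \<le> (LINT x|Omega. (cmod (p x))\<^sup>2)" "0 \<le> (LINT x|Omega. (cmod (v x))\<^sup>2)"
    "0 \<le> (LINT \<tau>|\<nu>. (cmod (\<psi> \<tau> 0))\<^sup>2)" "0 \<le> (LINT \<tau>|\<nu>. (cmod (\<psi> \<tau> 1))\<^sup>2)"
    by (auto intro!: Bochner_Integration.integral_nonneg)
  then show "(LINT x|Omega. (cmod (p x))\<^sup>2) \<le> (energy_norm \<nu> (p, v, \<psi>))\<^sup>2"
    "(LINT x|Omega. (cmod (v x))\<^sup>2) \<le> (energy_norm \<nu> (p, v, \<psi>))\<^sup>2"
    "x \<in> boundary \<Longrightarrow> (LINT \<tau>|\<nu>. (cmod (\<psi> \<tau> x))\<^sup>2) \<le> (energy_norm \<nu> (p, v, \<psi>))\<^sup>2"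
    unfolding energy_norm_square[OF assms] by auto
qed

context relaxation_measure
begin

lemma resolvent_kernel_mult:
  "0 < \<tau> \<Longrightarrow> (\<i> * complex_of_real \<sigma> + complex_of_real \<tau>) * (resolvent_kernel \<sigma> \<tau> * y) = y"
  using shifted_rate_nonzero[of \<tau> \<sigma>] by (simp add: field_simps)

lemma norm_resolvent_kernel_le_1:
  assumes "1 \<le> \<bar>\<sigma>\<bar>"
  shows "cmod (resolvent_kernel \<sigma> \<tau>) \<le> 1"
proof -
  have "1 \<le> cmod (\<i> * complex_of_real \<sigma> + complex_of_real \<tau>)"
    using abs_Im_le_cmod[of "\<i> * complex_of_real \<sigma> + complex_of_real \<tau>"] assms by simp
  then show ?thesis by (simp add: norm_divide divide_le_eq_1)
qed

lemma resolvent_kernel_mult_L2: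
  assumes \<sigma>: "1 \<le> \<bar>\<sigma>\<bar>" and h: "h \<in> L2 \<nu>"
  shows "(\<lambda>\<tau>. resolvent_kernel \<sigma> \<tau> * (y + h \<tau>)) \<in> L2 \<nu>"
proof -
  note [measurable] = L2_measurable[OF h]
  have "(\<lambda>\<tau>. resolvent_kernel \<sigma> \<tau> * h \<tau>) \<in> L2 \<nu>"
  proof (rule L2_dominated[OF h, where c = 1])
    show "AE \<tau> in \<nu>. cmod (resolvent_kernel \<sigma> \<tau> * h \<tau>) \<le> 1 * cmod (h \<tau>)"
      unfolding norm_mult by (intro AE_I2 mult_right_mono norm_resolvent_kernel_le_1 \<sigma>) simp
  qed measurable
  from L2_add[OF L2_scale[OF resolvent_kernel_L2(1)[OF \<sigma>], of y] this]
  show ?thesis by (simp add: algebra_simps add_divide_distrib)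
qed

text \<open>The part of the boundary flux \<open>\<integral> \<psi> d\<nu>\<close> that comes from the data \<open>h\<close> rather than from the pressure.\<close>

definition memory_flux :: "real \<Rightarrow> (real \<Rightarrow> complex) \<Rightarrow> complex" where
  "memory_flux \<sigma> h = (LINT \<tau>|\<nu>. resolvent_kernel \<sigma> \<tau> * h \<tau>)"

lemma integral_resolvent_kernel:
  assumes \<sigma>: "1 \<le> \<bar>\<sigma>\<bar>" and h: "h \<in> L2 \<nu>"
  shows "(LINT \<tau>|\<nu>. resolvent_kernel \<sigma> \<tau> * (y + h \<tau>)) = \<kappa> \<sigma> * y + memory_flux \<sigma> h"
proof -
  have "(LINT \<tau>|\<nu>. resolvent_kernel \<sigma> \<tau> * y + resolvent_kernel \<sigma> \<tau> * h \<tau>)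
      = (LINT \<tau>|\<nu>. resolvent_kernel \<sigma> \<tau> * y) + (LINT \<tau>|\<nu>. resolvent_kernel \<sigma> \<tau> * h \<tau>)"
    by (intro Bochner_Integration.integral_add integrable_mult_left integrable_resolvent_kernel
        L2_integrable_mult resolvent_kernel_L2 \<sigma> h)
  then show ?thesis
    by (simp only: distrib_left memory_flux_def khat_def integral_mult_left_zero)
qed

lemma norm_memory_flux_le:
  assumes \<sigma>: "1 \<le> \<bar>\<sigma>\<bar>" and h: "h \<in> L2 \<nu>" "(LINT \<tau>|\<nu>. (cmod (h \<tau>))\<^sup>2) \<le> e\<^sup>2" "0 \<le> e"
  shows "cmod (memory_flux \<sigma> h) \<le> (1 + K) * e"
proof -
  have "K \<le> (1 + K)\<^sup>2" using K_nonneg by (simp add: power2_eq_square algebra_simps)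
  then have le: "(LINT \<tau>|\<nu>. (cmod (resolvent_kernel \<sigma> \<tau>))\<^sup>2) \<le> (1 + K)\<^sup>2"
    using resolvent_kernel_L2(2)[OF \<sigma>] by linarith
  have "cmod (memory_flux \<sigma> h) \<le> (LINT \<tau>|\<nu>. cmod (resolvent_kernel \<sigma> \<tau> * h \<tau>))"
    unfolding memory_flux_def by (rule integral_norm_bound)
  also have "\<dots> = (LINT \<tau>|\<nu>. cmod (resolvent_kernel \<sigma> \<tau>) * cmod (h \<tau>))"
    by (simp only: norm_mult)
  also have "\<dots> \<le> (1 + K) * e"
    using K_nonneg by (intro integral_mult_le_L2 resolvent_kernel_L2(1) \<sigma> h le) auto
  finally show ?thesis .
qed

text \<open>For given \<open>p\<close>, \<open>v\<close> and \<open>h\<close> the third component of the resolvent equation determines \<open>\<psi>\<close>. Membership in the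
  domain then amounts to two impedance conditions. This serves both the existence of solutions and the
  construction of quasimodes. That \<open>\<tau> \<psi> - p\<close> is square integrable follows from rewriting it as \<open>h - i\<sigma> \<psi>\<close>.\<close>

lemma wave_domain_I:
  assumes \<sigma>: "1 \<le> \<bar>\<sigma>\<bar>"
    and p: "continuous_on {0..1} p" "p' \<in> L2 Omega" "weak_derivative p p'"
    and v: "continuous_on {0..1} v" "v' \<in> L2 Omega" "weak_derivative v v'"
    and h: "h \<in> L2_boundary \<nu>"
    and bc: "v 1 = \<kappa> \<sigma> * p 1 + memory_flux \<sigma> (\<lambda>\<tau>. h \<tau> 1)"
      "- v 0 = \<kappa> \<sigma> * p 0 + memory_flux \<sigma> (\<lambda>\<tau>. h \<tau> 0)"
  defines "\<psi> \<equiv> \<lambda>\<tau> x. resolvent_kernel \<sigma> \<tau> * (p x + h \<tau> x)"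
  shows "(p, v, \<psi>) \<in> wave_domain \<nu>"
    and "state_eq \<nu> (shifted_wave_op \<sigma> (p, v, \<psi>))
      (\<lambda>x. \<i> * complex_of_real \<sigma> * p x + v' x, \<lambda>x. \<i> * complex_of_real \<sigma> * v x + p' x, h)"
proof -
  have L2: "p \<in> L2 Omega" "v \<in> L2 Omega" by (intro continuous_on_L2_Omega p v)+
  have H1: "p \<in> H1" "v \<in> H1" using L2 p v by (auto intro: H1_I)
  have tr: "boundary_trace p x = p x" "boundary_trace v x = v x" if "x \<in> boundary" for x
    using that by (auto intro!: boundary_trace_eq p v)
  have \<psi>_L2: "(\<lambda>\<tau>. \<psi> \<tau> x) \<in> L2 \<nu>" if "x \<in> boundary" for x
    unfolding \<psi>_def by (intro resolvent_kernel_mult_L2 \<sigma> L2_boundary_D[OF h that])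
  have eq: "complex_of_real \<tau> * \<psi> \<tau> x - p x = h \<tau> x - \<i> * complex_of_real \<sigma> * \<psi> \<tau> x" if "0 < \<tau>" for \<tau> x
  proof -
    have "(\<i> * complex_of_real \<sigma> + complex_of_real \<tau>) * \<psi> \<tau> x = p x + h \<tau> x"
      unfolding \<psi>_def by (rule resolvent_kernel_mult[OF that])
    then show ?thesis by (simp add: algebra_simps)
  qed
  have "(\<lambda>\<tau>. complex_of_real \<tau> * \<psi> \<tau> x - p x) \<in> L2 \<nu>" if x: "x \<in> boundary" for x
  proof (rule L2_dominated[where c = 1])
    show "(\<lambda>\<tau>. h \<tau> x - \<i> * complex_of_real \<sigma> * \<psi> \<tau> x) \<in> L2 \<nu>"
      by (intro L2_diff L2_scale L2_boundary_D[OF h x] \<psi>_L2 x)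
    note [measurable] = L2_measurable[OF \<psi>_L2[OF x]]
    show "(\<lambda>\<tau>. complex_of_real \<tau> * \<psi> \<tau> x - p x) \<in> borel_measurable \<nu>" by measurable
  qed (intro AE_I_pos, simp add: eq)
  moreover have "(LINT \<tau>|\<nu>. \<psi> \<tau> x) = \<kappa> \<sigma> * p x + memory_flux \<sigma> (\<lambda>\<tau>. h \<tau> x)" if "x \<in> boundary" for x
    unfolding \<psi>_def by (intro integral_resolvent_kernel \<sigma> L2_boundary_D[OF h that])
  ultimately show "(p, v, \<psi>) \<in> wave_domain \<nu>"
    using L2 H1 \<psi>_L2 bc
    by (auto simp: wave_domain_def energy_space_def grad_H1_eq_L2_Omega L2_boundary_def tr outer_normal_def)
  have "AE x in Omega. wderiv p x = p' x" "AE x in Omega. wderiv v x = v' x"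
    by (intro wderiv_AE L2 p v)+
  moreover have "AE \<tau> in \<nu>. \<forall>x\<in>boundary. \<i> * complex_of_real \<sigma> * \<psi> \<tau> x + (complex_of_real \<tau> * \<psi> \<tau> x - boundary_trace p x) = h \<tau> x"
    by (intro AE_I_pos) (auto simp: eq tr)
  ultimately show "state_eq \<nu> (shifted_wave_op \<sigma> (p, v, \<psi>))
      (\<lambda>x. \<i> * complex_of_real \<sigma> * p x + v' x, \<lambda>x. \<i> * complex_of_real \<sigma> * v x + p' x, h)"
    by (simp add: shifted_wave_op_def)
qed

text \<open>One factor \<open>(1 + K)\<^sup>2\<close> comes from Cramer's rule and another \<open>1 + K\<close> from recovering \<open>\<psi>\<close>.\<close>

definition resolvent_constant :: real where
  "resolvent_constant = 12 * (1 + K) ^ 3"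

text \<open>The invariants \<open>a\<close> and \<open>b\<close> are given by Duhamel's formula, with initial values that solve the boundary system.\<close>

lemma resolvent_equation_solvable:
  assumes \<sigma>: "1 \<le> \<bar>\<sigma>\<bar>" and F: "F \<in> energy_space \<nu>"
  shows "\<exists>U \<in> wave_domain \<nu>. state_eq \<nu> (shifted_wave_op \<sigma> U) F"
proof -
  obtain f g h where F_eq: "F = (f, g, h)" by (cases F)
  then have f: "f \<in> L2 Omega" and g: "g \<in> L2 Omega" and h: "h \<in> L2_boundary \<nu>"
    using F by (auto simp: energy_space_def grad_H1_eq_L2_Omega)
  define s where "s = \<i> * complex_of_real \<sigma>"
  have fg: "(\<lambda>x. f x + g x) \<in> L2 Omega" "(\<lambda>x. g x - f x) \<in> L2 Omega"
    by (intro L2_add L2_diff f g)+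
  define A where "A = primitive (\<lambda>y. exp (- (- s) * complex_of_real y) * (f y + g y)) 1"
  define B where "B = primitive (\<lambda>y. exp (- s * complex_of_real y) * (g y - f y)) 1"
  have z: "cmod (exp s) = 1" by (simp add: s_def norm_exp)
  obtain a0 b0 where
    bc0: "(1 + \<kappa> \<sigma>) * a0 = (1 - \<kappa> \<sigma>) * b0 - 2 * memory_flux \<sigma> (\<lambda>\<tau>. h \<tau> 0)" and
    bc1: "(1 - \<kappa> \<sigma>) * (inverse (exp s) * (a0 + A)) =
      (1 + \<kappa> \<sigma>) * (exp s * (b0 + B)) + 2 * memory_flux \<sigma> (\<lambda>\<tau>. h \<tau> 1)"
    using boundary_system_solvable[OF z Re_khat_pos] by blast
  define a where "a = duhamel (- s) a0 (\<lambda>x. f x + g x)"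
  define b where "b = duhamel s b0 (\<lambda>x. g x - f x)"
  define p where "p x = 1/2 * (a x + b x)" for x
  define v where "v x = 1/2 * (a x - b x)" for x
  have a: "continuous_on {0..1} a" "weak_derivative a (\<lambda>x. - s * a x + (f x + g x))"
    and b: "continuous_on {0..1} b" "weak_derivative b (\<lambda>x. s * b x + (g x - f x))"
    unfolding a_def b_def by (intro continuous_on_duhamel weak_derivative_duhamel fg)+
  have L2: "a \<in> L2 Omega" "b \<in> L2 Omega" by (intro continuous_on_L2_Omega a b)+
  have L2': "(\<lambda>x. - s * a x + (f x + g x)) \<in> L2 Omega" "(\<lambda>x. s * b x + (g x - f x)) \<in> L2 Omega"
    by (intro L2_add L2_scale L2 fg f g)+
  have p': "weak_derivative p (\<lambda>x. - s * v x + g x)"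
  proof -
    have "(\<lambda>x. - s * v x + g x) = (\<lambda>x. 1/2 * ((- s * a x + (f x + g x)) + (s * b x + (g x - f x))))"
      by (auto simp: v_def fun_eq_iff field_simps)
    then show ?thesis
      unfolding p_def[abs_def]
      using weak_derivative_scale[OF weak_derivative_add[OF a(2) b(2) L2(1) L2'(1) L2(2) L2'(2)], of "1/2"] by simp
  qed
  have v': "weak_derivative v (\<lambda>x. - s * p x + f x)"
  proof -
    have "(\<lambda>x. - s * p x + f x) = (\<lambda>x. 1/2 * ((- s * a x + (f x + g x)) - (s * b x + (g x - f x))))"
      by (auto simp: p_def fun_eq_iff field_simps)
    then show ?thesis
      unfolding v_def[abs_def]
      using weak_derivative_scale[OF weak_derivative_diff[OF a(2) b(2) L2(1) L2'(1) L2(2) L2'(2)], of "1/2"] by simp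
  qed
  have cont: "continuous_on {0..1} p" "continuous_on {0..1} v"
    unfolding p_def v_def by (intro continuous_intros a b)+
  have ab0: "a 0 = a0" "b 0 = b0" by (simp_all add: a_def b_def)
  have ab1: "a 1 = inverse (exp s) * (a0 + A)" "b 1 = exp s * (b0 + B)"
    by (simp_all add: a_def b_def duhamel_def A_def B_def exp_minus)
  have "v 1 = \<kappa> \<sigma> * p 1 + memory_flux \<sigma> (\<lambda>\<tau>. h \<tau> 1)"
  proof -
    have "a 1 - b 1 = \<kappa> \<sigma> * (a 1 + b 1) + 2 * memory_flux \<sigma> (\<lambda>\<tau>. h \<tau> 1)"
      using bc1 unfolding ab1[symmetric] by (simp add: algebra_simps)
    then show ?thesis unfolding v_def p_def by (simp add: distrib_left)
  qed
  moreover have "- v 0 = \<kappa> \<sigma> * p 0 + memory_flux \<sigma> (\<lambda>\<tau>. h \<tau> 0)"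
  proof -
    have "b 0 - a 0 = \<kappa> \<sigma> * (a 0 + b 0) + 2 * memory_flux \<sigma> (\<lambda>\<tau>. h \<tau> 0)"
      using bc0 unfolding ab0[symmetric] by (simp add: algebra_simps)
    moreover have "- v 0 = 1/2 * (b 0 - a 0)" by (simp add: v_def field_simps)
    ultimately show ?thesis unfolding p_def by (simp add: distrib_left)
  qed
  moreover have "(\<lambda>x. - s * v x + g x) \<in> L2 Omega" "(\<lambda>x. - s * p x + f x) \<in> L2 Omega"
    by (intro L2_add L2_scale continuous_on_L2_Omega cont f g)+
  ultimately show ?thesis
    using wave_domain_I[OF \<sigma> cont(1) _ p' cont(2) _ v' h] F_eq
    by (auto simp: s_def intro!: bexI)
qed

text \<open>Conversely, every solution has invariants of Duhamel form, whose initial values satisfy the boundary system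
  and are thereby bounded by a multiple of \<open>e / Re \<kappa>\<close>, where \<open>e\<close> is the norm of the data. Propagation along the
  interval is unitary, so the same bound holds pointwise for \<open>p\<close> and \<open>v\<close>, and then for \<open>\<psi>\<close>.\<close>

lemma resolvent_estimate:
  assumes \<sigma>: "1 \<le> \<bar>\<sigma>\<bar>" and F: "F \<in> energy_space \<nu>" and U: "U \<in> wave_domain \<nu>"
    and eq: "state_eq \<nu> (shifted_wave_op \<sigma> U) F"
  shows "energy_norm \<nu> U \<le> resolvent_constant / Re (\<kappa> \<sigma>) * energy_norm \<nu> F"
proof -
  obtain f g h where F_eq: "F = (f, g, h)" by (cases F)
  then have f: "f \<in> L2 Omega" and g: "g \<in> L2 Omega" and h: "h \<in> L2_boundary \<nu>"
    using F by (auto simp: energy_space_def grad_H1_eq_L2_Omega)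
  obtain p v \<psi> where U_eq: "U = (p, v, \<psi>)" by (cases U)
  have p: "p \<in> H1" and v: "v \<in> H1" and \<psi>: "\<psi> \<in> L2_boundary \<nu>"
    and bc: "\<And>x. x \<in> boundary \<Longrightarrow> - boundary_trace v x * complex_of_real (outer_normal x) + (LINT \<tau>|\<nu>. \<psi> \<tau> x) = 0"
    using U by (auto simp: U_eq wave_domain_def energy_space_def)
  define s where "s = \<i> * complex_of_real \<sigma>"
  have eq1: "AE x in Omega. s * p x + wderiv v x = f x"
    and eq2: "AE x in Omega. s * v x + wderiv p x = g x"
    and eq3: "AE \<tau> in \<nu>. \<forall>x\<in>boundary. s * \<psi> \<tau> x + (complex_of_real \<tau> * \<psi> \<tau> x - boundary_trace p x) = h \<tau> x"
    using eq by (simp_all add: F_eq U_eq shifted_wave_op_def s_def)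
  have eq1': "AE x in Omega. wderiv v x = f x - s * p x" and eq2': "AE x in Omega. wderiv p x = g x - s * v x"
    using eq1 eq2 by (eventually_elim, simp add: eq_diff_eq add.commute)+
  define e where "e = energy_norm \<nu> F"
  have e: "0 \<le> e" unfolding e_def by (rule energy_norm_nonneg)
  note comp = energy_norm_components[OF f g h, folded F_eq e_def]
  have fg: "(\<lambda>x. f x + g x) \<in> L2 Omega" "(\<lambda>x. g x - f x) \<in> L2 Omega"
    by (intro L2_add L2_diff f g)+
  have int_fg: "(LINT x|Omega. cmod (f x + g x)) \<le> 2 * e" "(LINT x|Omega. cmod (g x - f x)) \<le> 2 * e"
  proof -
    have ie: "integrable Omega (\<lambda>x. cmod (f x))" "integrable Omega (\<lambda>x. cmod (g x))"
      by (intro integrable_norm L2_Omega_integrable f g)+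
    have "(LINT x|Omega. cmod (f x) + cmod (g x)) \<le> 2 * e"
      using L2_Omega_integral_norm_le[OF f comp(1) e] L2_Omega_integral_norm_le[OF g comp(2) e] ie by simp
    moreover have "(LINT x|Omega. cmod (f x + g x)) \<le> (LINT x|Omega. cmod (f x) + cmod (g x))"
      "(LINT x|Omega. cmod (g x - f x)) \<le> (LINT x|Omega. cmod (f x) + cmod (g x))"
      by (intro integral_mono integrable_norm L2_Omega_integrable fg Bochner_Integration.integrable_add ie
          norm_triangle_ineq norm_triangle_ineq4[of "g _" "f _", unfolded add.commute[of "cmod (g _)"]])+
    ultimately show "(LINT x|Omega. cmod (f x + g x)) \<le> 2 * e" "(LINT x|Omega. cmod (g x - f x)) \<le> 2 * e"
      by linarith+
  qed
  have pv: "p \<in> L2 Omega" "v \<in> L2 Omega" "wderiv p \<in> L2 Omega" "wderiv v \<in> L2 Omega"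
    "weak_derivative p (wderiv p)" "weak_derivative v (wderiv v)"
    using p v by (auto intro: H1_L2 wderiv_spec)
  have "AE x in Omega. wderiv p x + wderiv v x = - s * (p x + v x) + (f x + g x)"
    using eq1' eq2' by eventually_elim (simp only:, simp add: algebra_simps)
  then obtain a0 where a0: "AE x in Omega. duhamel (- s) a0 (\<lambda>x. f x + g x) x = p x + v x"
    using weak_ODE_solution[OF L2_add[OF pv(1,2)] L2_add[OF pv(3,4)]
        weak_derivative_add[OF pv(5,6,1,3,2,4)] fg(1)] by blast
  have "AE x in Omega. wderiv p x - wderiv v x = s * (p x - v x) + (g x - f x)"
    using eq1' eq2' by eventually_elim (simp only:, simp add: algebra_simps)
  then obtain b0 where b0: "AE x in Omega. duhamel s b0 (\<lambda>x. g x - f x) x = p x - v x"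
    using weak_ODE_solution[OF L2_diff[OF pv(1,2)] L2_diff[OF pv(3,4)]
        weak_derivative_diff[OF pv(5,6,1,3,2,4)] fg(2)] by blast
  define a where "a = duhamel (- s) a0 (\<lambda>x. f x + g x)"
  define b where "b = duhamel s b0 (\<lambda>x. g x - f x)"
  define P where "P x = 1/2 * (a x + b x)" for x
  define V where "V x = 1/2 * (a x - b x)" for x
  have "continuous_on {0..1} a" "continuous_on {0..1} b"
    unfolding a_def b_def by (intro continuous_on_duhamel fg)+
  then have cont: "continuous_on {0..1} P" "continuous_on {0..1} V"
    unfolding P_def V_def by (auto intro!: continuous_intros)
  have P_eq: "AE x in Omega. P x = p x" and V_eq: "AE x in Omega. V x = v x"
    using a0 b0 unfolding a_def[symmetric] b_def[symmetric]
    by (eventually_elim, simp add: P_def V_def)+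
  have tr: "boundary_trace p x = P x" "boundary_trace v x = V x" if "x \<in> boundary" for x
    using that by (auto intro!: boundary_trace_eq cont P_eq V_eq)
  have \<psi>_eq: "AE \<tau> in \<nu>. \<forall>x\<in>boundary. \<psi> \<tau> x = resolvent_kernel \<sigma> \<tau> * (P x + h \<tau> x)"
    using eq3 AE_pos
  proof eventually_elim
    case (elim \<tau>)
    show ?case
    proof
      fix x :: real assume x: "x \<in> boundary"
      have "(s + complex_of_real \<tau>) * \<psi> \<tau> x = P x + h \<tau> x"
        using elim(1)[rule_format, OF x] unfolding tr[OF x] by (simp add: algebra_simps)
      then show "\<psi> \<tau> x = resolvent_kernel \<sigma> \<tau> * (P x + h \<tau> x)"
        using shifted_rate_nonzero[OF elim(2), of \<sigma>] by (simp add: s_def field_simps)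
    qed
  qed
  have flux: "(LINT \<tau>|\<nu>. \<psi> \<tau> x) = \<kappa> \<sigma> * P x + memory_flux \<sigma> (\<lambda>\<tau>. h \<tau> x)" if x: "x \<in> boundary" for x
  proof -
    have "(LINT \<tau>|\<nu>. \<psi> \<tau> x) = (LINT \<tau>|\<nu>. resolvent_kernel \<sigma> \<tau> * (P x + h \<tau> x))"
      by (intro integral_cong_AE L2_measurable L2_boundary_D[OF \<psi> x] resolvent_kernel_mult_L2 \<sigma> L2_boundary_D[OF h x])
         (rule AE_mp[OF \<psi>_eq], use x in \<open>blast intro: AE_I2\<close>)
    then show ?thesis
      using integral_resolvent_kernel[OF \<sigma> L2_boundary_D[OF h x]] by simp
  qed
  define R where "R = Re (\<kappa> \<sigma>)"
  have R: "0 < R" unfolding R_def by (rule Re_khat_pos)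
  have RK: "R \<le> 1 + K"
    using norm_khat_le[of \<sigma>] complex_Re_le_cmod[of "\<kappa> \<sigma>"] by (simp add: R_def)
  define Q where "Q = 4 * (1 + K)\<^sup>2 * e / R"
  define A where "A = primitive (\<lambda>y. exp (- (- s) * complex_of_real y) * (f y + g y)) 1"
  define B where "B = primitive (\<lambda>y. exp (- s * complex_of_real y) * (g y - f y)) 1"
  have Re_s: "Re s = 0" "Re (- s) = 0" by (simp_all add: s_def)
  have AB: "cmod A \<le> 2 * e" "cmod B \<le> 2 * e"
  proof -
    have "cmod (primitive (\<lambda>y. exp (\<mu> * complex_of_real y) * G y) 1) \<le> 2 * e"
      if G: "G \<in> L2 Omega" "(LINT x|Omega. cmod (G x)) \<le> 2 * e" and \<mu>: "Re \<mu> = 0" for \<mu> G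
    proof -
      have "cmod (primitive (\<lambda>y. exp (\<mu> * complex_of_real y) * G y) 1)
          \<le> (LINT y|Omega. cmod (exp (\<mu> * complex_of_real y) * G y))"
        by (intro norm_primitive_le L2_Omega_integrable L2_exp_mult G)
      with G(2) show ?thesis by (simp add: norm_mult \<mu>)
    qed
    from this[OF fg(1) int_fg(1), of "- (- s)"] this[OF fg(2) int_fg(2), of "- s"] Re_s
    show "cmod A \<le> 2 * e" "cmod B \<le> 2 * e" by (simp_all add: A_def B_def)
  qed
  have ab0: "a 0 = a0" "b 0 = b0" by (simp_all add: a_def b_def)
  have ab1: "a 1 = inverse (exp s) * (a0 + A)" "b 1 = exp s * (b0 + B)"
    by (simp_all add: a_def b_def duhamel_def A_def B_def exp_minus)
  \<comment> \<open>\<open>P\<close> and \<open>V\<close> are the continuous representatives, whose end point values enter the boundary system.\<close>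
  have PV2: "2 * P x = a x + b x" "2 * V x = a x - b x" for x
    by (simp_all add: P_def V_def)
  have bc0: "(1 + \<kappa> \<sigma>) * a0 = (1 - \<kappa> \<sigma>) * b0 - 2 * memory_flux \<sigma> (\<lambda>\<tau>. h \<tau> 0)"
  proof -
    have "V 0 + (\<kappa> \<sigma> * P 0 + memory_flux \<sigma> (\<lambda>\<tau>. h \<tau> 0)) = 0"
      using bc[of 0] flux[of 0] tr[of 0] by (simp add: outer_normal_def)
    then have "2 * V 0 + (\<kappa> \<sigma> * (2 * P 0) + 2 * memory_flux \<sigma> (\<lambda>\<tau>. h \<tau> 0)) = 0"
      by (metis distrib_left mult.left_commute mult_zero_right)
    then show ?thesis unfolding PV2 ab0 by (simp add: algebra_simps eq_diff_eq)
  qed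
  have bc1: "(1 - \<kappa> \<sigma>) * (inverse (exp s) * (a0 + A)) =
      (1 + \<kappa> \<sigma>) * (exp s * (b0 + B)) + 2 * memory_flux \<sigma> (\<lambda>\<tau>. h \<tau> 1)"
  proof -
    have "V 1 = \<kappa> \<sigma> * P 1 + memory_flux \<sigma> (\<lambda>\<tau>. h \<tau> 1)"
      using bc[of 1] flux[of 1] tr[of 1] by (simp add: outer_normal_def)
    then have "2 * V 1 = \<kappa> \<sigma> * (2 * P 1) + 2 * memory_flux \<sigma> (\<lambda>\<tau>. h \<tau> 1)"
      by (metis distrib_left mult.left_commute)
    then show ?thesis unfolding PV2 ab1[symmetric] by (simp add: algebra_simps)
  qed
  have z: "cmod (exp s) = 1" by (simp add: Re_s)
  have flux_le: "cmod (memory_flux \<sigma> (\<lambda>\<tau>. h \<tau> x)) \<le> (1 + K) * e" if x: "x \<in> boundary" for x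
    by (intro norm_memory_flux_le \<sigma> L2_boundary_D[OF h x] comp(3)[OF x] e)
  have "cmod a0 \<le> 2 * (1 + K)\<^sup>2 * e / R" "cmod b0 \<le> 2 * (1 + K)\<^sup>2 * e / R"
    using boundary_system_bound[OF z Re_khat_pos norm_khat_le bc0 bc1 _ _ AB] flux_le by (auto simp: R_def)
  then have ab0_le: "cmod a0 \<le> Q / 2" "cmod b0 \<le> Q / 2" by (simp_all add: Q_def ac_simps)
  \<comment> \<open>Absorbs the direct contribution of the data, as \<open>Re \<kappa> \<le> 1 + K\<close>.\<close>
  have eQ: "e \<le> Q / 4"
  proof -
    have "e * R \<le> e * (1 + K)\<^sup>2"
      using RK K_nonneg e
      by (intro mult_left_mono) (auto simp: power2_eq_square intro!: order_trans[OF RK] mult_left_mono)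
    then show ?thesis using R by (simp add: Q_def field_simps)
  qed
  have ab_le: "cmod (a x) \<le> Q" "cmod (b x) \<le> Q" for x
    using norm_duhamel_le[OF fg(1) Re_s(2), of a0 x] norm_duhamel_le[OF fg(2) Re_s(1), of b0 x]
      int_fg ab0_le eQ by (simp_all add: a_def b_def)
  have PV_le: "cmod (P x) \<le> Q" "cmod (V x) \<le> Q" for x
    using norm_triangle_ineq[of "a x" "b x"] norm_triangle_ineq4[of "a x" "b x"] ab_le[of x]
    by (simp_all add: P_def V_def norm_mult)
  have Q: "0 \<le> Q" using PV_le(1)[of 0] norm_ge_zero order_trans by blast
  have pv_int: "(LINT x|Omega. (cmod (u x))\<^sup>2) \<le> Q\<^sup>2"
    if u: "u \<in> L2 Omega" and uW: "AE x in Omega. W x = u x" and W: "\<And>x. cmod (W x) \<le> Q" for u W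
  proof -
    have "(LINT x|Omega. (cmod (u x))\<^sup>2) \<le> (LINT x|Omega. Q\<^sup>2)"
    proof (intro integral_mono_AE L2_integrable_square u)
      show "AE x in Omega. (cmod (u x))\<^sup>2 \<le> Q\<^sup>2"
        using uW
      proof eventually_elim
        case (elim x)
        then show ?case using W[of x] by (intro power_mono) auto
      qed
    qed simp
    then show ?thesis by simp
  qed
  have \<psi>_int: "(LINT \<tau>|\<nu>. (cmod (\<psi> \<tau> x))\<^sup>2) \<le> 2 * Q\<^sup>2 * K + 2 * e\<^sup>2" if x: "x \<in> boundary" for x
  proof -
    have "(LINT \<tau>|\<nu>. (cmod (\<psi> \<tau> x))\<^sup>2) \<le>
        (LINT \<tau>|\<nu>. 2 * Q\<^sup>2 * (cmod (resolvent_kernel \<sigma> \<tau>))\<^sup>2 + 2 * (cmod (h \<tau> x))\<^sup>2)"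
    proof (intro integral_mono_AE L2_integrable_square L2_boundary_D[OF \<psi> x] Bochner_Integration.integrable_add
        integrable_mult_right resolvent_kernel_L2(1)[OF \<sigma>] L2_boundary_D[OF h x])
      show "AE \<tau> in \<nu>. (cmod (\<psi> \<tau> x))\<^sup>2 \<le> 2 * Q\<^sup>2 * (cmod (resolvent_kernel \<sigma> \<tau>))\<^sup>2 + 2 * (cmod (h \<tau> x))\<^sup>2"
        using \<psi>_eq
      proof eventually_elim
        case (elim \<tau>)
        let ?r = "cmod (resolvent_kernel \<sigma> \<tau>)"
        have r: "0 \<le> ?r" "?r \<le> 1" using norm_resolvent_kernel_le_1[OF \<sigma>] by auto
        have "cmod (\<psi> \<tau> x) = ?r * cmod (P x + h \<tau> x)"
          using elim x by (simp only: norm_mult)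
        also have "\<dots> \<le> ?r * (Q + cmod (h \<tau> x))"
          using norm_triangle_ineq[of "P x" "h \<tau> x"] PV_le(1)[of x] by (intro mult_left_mono[OF _ r(1)]) linarith
        also have "\<dots> \<le> Q * ?r + cmod (h \<tau> x)"
          using mult_right_mono[OF r(2), of "cmod (h \<tau> x)"] by (simp add: algebra_simps)
        finally have "(cmod (\<psi> \<tau> x))\<^sup>2 \<le> (Q * ?r + cmod (h \<tau> x))\<^sup>2" by (intro power_mono) auto
        also have "\<dots> \<le> 2 * (Q * ?r)\<^sup>2 + 2 * (cmod (h \<tau> x))\<^sup>2"
          using sum_squares_bound[of "Q * ?r" "cmod (h \<tau> x)"] by (simp only: power2_sum)
        finally show ?case by (simp only: power_mult_distrib mult.assoc)
      qed
    qed
    also have "\<dots> = 2 * Q\<^sup>2 * (LINT \<tau>|\<nu>. (cmod (resolvent_kernel \<sigma> \<tau>))\<^sup>2) + 2 * (LINT \<tau>|\<nu>. (cmod (h \<tau> x))\<^sup>2)"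
      by (simp only: Bochner_Integration.integral_add integrable_mult_right integral_mult_right_zero
          L2_integrable_square[OF resolvent_kernel_L2(1)[OF \<sigma>]] L2_integrable_square[OF L2_boundary_D[OF h x]])
    also have "\<dots> \<le> 2 * Q\<^sup>2 * K + 2 * e\<^sup>2"
      by (intro add_mono mult_left_mono resolvent_kernel_L2 \<sigma> comp x) auto
    finally show ?thesis .
  qed
  have "(energy_norm \<nu> U)\<^sup>2 \<le> Q\<^sup>2 + Q\<^sup>2 + (2 * Q\<^sup>2 * K + 2 * e\<^sup>2) + (2 * Q\<^sup>2 * K + 2 * e\<^sup>2)"
    unfolding U_eq energy_norm_square[OF pv(1,2) \<psi>]
    by (intro add_mono pv_int[OF pv(1) P_eq PV_le(1)] pv_int[OF pv(2) V_eq PV_le(2)] \<psi>_int) auto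
  also have "\<dots> \<le> (6 + 4 * K) * Q\<^sup>2"
  proof -
    have "e\<^sup>2 \<le> Q\<^sup>2" using eQ e Q by (intro power_mono) auto
    then show ?thesis by (simp add: algebra_simps)
  qed
  also have "\<dots> \<le> (3 * (1 + K))\<^sup>2 * Q\<^sup>2"
    using K_nonneg by (intro mult_right_mono) (auto simp: power2_eq_square algebra_simps)
  finally have "(energy_norm \<nu> U)\<^sup>2 \<le> (3 * (1 + K) * Q)\<^sup>2" by (simp add: power_mult_distrib)
  then have "energy_norm \<nu> U \<le> 3 * (1 + K) * Q"
    by (rule power2_le_imp_le) (use K_nonneg Q in auto)
  also have "\<dots> = resolvent_constant / Re (\<kappa> \<sigma>) * energy_norm \<nu> F"
    by (simp add: Q_def resolvent_constant_def R_def e_def power2_eq_square power3_eq_cube)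
  finally show ?thesis .
qed

lemma resolvent_norm_le:
  assumes "1 \<le> \<bar>\<sigma>\<bar>"
  shows "resolvent_norm \<nu> \<sigma> \<le> ereal (resolvent_constant / Re (\<kappa> \<sigma>))"
proof -
  have "inverse_bound \<nu> \<sigma> (resolvent_constant / Re (\<kappa> \<sigma>))"
    unfolding inverse_bound_def
    using resolvent_equation_solvable[OF assms] resolvent_estimate[OF assms] Re_khat_pos[of \<sigma>] K_nonneg
    by (auto simp: resolvent_constant_def)
  then show ?thesis
    unfolding resolvent_norm_def by (intro INF_lower) simp
qed

section \<open>Quasimodes and the lower bound\<close>

text \<open>With \<open>p = cosh (w (x - 1/2))\<close> and \<open>v = sinh (w (x - 1/2))\<close> the hypothesis on \<open>w\<close> says \<open>v 1 = \<kappa> p 1\<close>, and the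
  condition at 0 follows by symmetry. The data of this state are \<open>(i\<sigma> + w) (p, v, 0)\<close>.\<close>

lemma resolvent_norm_ge:
  assumes \<sigma>: "1 \<le> \<bar>\<sigma>\<bar>" and w: "exp w * (1 - \<kappa> \<sigma>) = 1 + \<kappa> \<sigma>"
    and L: "cmod (\<i> * complex_of_real \<sigma> + w) \<le> L" "0 < L"
  shows "ereal (1 / L) \<le> resolvent_norm \<nu> \<sigma>"
proof -
  define s where "s = \<i> * complex_of_real \<sigma>"
  define a where "a x = exp (w * complex_of_real (x - 1/2))" for x :: real
  define b where "b x = exp (- w * complex_of_real (x - 1/2))" for x :: real
  define p where "p x = 1/2 * (a x + b x)" for x
  define v where "v x = 1/2 * (a x - b x)" for x
  have exp_weak: "weak_derivative (\<lambda>x. exp (\<mu> * complex_of_real (x - 1/2))) (\<lambda>x. \<mu> * exp (\<mu> * complex_of_real (x - 1/2)))" for \<mu>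
  proof -
    have "duhamel \<mu> (exp (- \<mu> / 2)) (\<lambda>_. 0) = (\<lambda>x. exp (\<mu> * complex_of_real (x - 1/2)))"
      by (auto simp: duhamel_def primitive_def fun_eq_iff exp_add[symmetric] algebra_simps)
    then show ?thesis using weak_derivative_duhamel[of "\<lambda>_. 0" \<mu> "exp (- \<mu> / 2)"] by simp
  qed
  have cont: "continuous_on {0..1} a" "continuous_on {0..1} b" "continuous_on {0..1} p" "continuous_on {0..1} v"
    unfolding p_def v_def a_def b_def by (intro continuous_intros)+
  have weak: "weak_derivative a (\<lambda>x. w * a x)" "weak_derivative b (\<lambda>x. - w * b x)"
    unfolding a_def b_def by (rule exp_weak)+
  have L2: "a \<in> L2 Omega" "b \<in> L2 Omega" "p \<in> L2 Omega" "v \<in> L2 Omega"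
    by (intro continuous_on_L2_Omega cont)+
  have L2': "(\<lambda>x. w * a x) \<in> L2 Omega" "(\<lambda>x. - w * b x) \<in> L2 Omega"
    by (intro L2_scale L2)+
  have p': "weak_derivative p (\<lambda>x. w * v x)"
  proof -
    have "(\<lambda>x. w * v x) = (\<lambda>x. 1/2 * (w * a x + - w * b x))"
      by (auto simp: v_def fun_eq_iff field_simps)
    then show ?thesis
      unfolding p_def[abs_def]
      using weak_derivative_scale[OF weak_derivative_add[OF weak L2(1) L2'(1) L2(2) L2'(2)], of "1/2"] by simp
  qed
  have v': "weak_derivative v (\<lambda>x. w * p x)"
  proof -
    have "(\<lambda>x. w * p x) = (\<lambda>x. 1/2 * (w * a x - - w * b x))"
      by (auto simp: p_def fun_eq_iff field_simps)
    then show ?thesis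
      unfolding v_def[abs_def]
      using weak_derivative_scale[OF weak_derivative_diff[OF weak L2(1) L2'(1) L2(2) L2'(2)], of "1/2"] by simp
  qed
  have bc: "v 1 = \<kappa> \<sigma> * p 1"
  proof -
    have "exp w = exp (w / 2) * exp (w / 2)" by (simp add: exp_add[symmetric])
    with w have "exp (- (w / 2)) * (exp (w / 2) * exp (w / 2) * (1 - \<kappa> \<sigma>)) = exp (- (w / 2)) * (1 + \<kappa> \<sigma>)" by simp
    then have "exp (w / 2) * (1 - \<kappa> \<sigma>) = exp (- (w / 2)) * (1 + \<kappa> \<sigma>)"
      by (simp add: mult.assoc[symmetric] exp_add[symmetric])
    then have "exp (w / 2) - exp (- (w / 2)) = \<kappa> \<sigma> * (exp (w / 2) + exp (- (w / 2)))"
      by (simp add: algebra_simps)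
    moreover have "a 1 = exp (w / 2)" "b 1 = exp (- (w / 2))" by (simp_all add: a_def b_def)
    ultimately show ?thesis by (simp add: p_def v_def)
  qed
  have sym: "p 0 = p 1" "v 0 = - v 1"
    by (simp_all add: p_def v_def a_def b_def field_simps)
  define \<psi> where "\<psi> \<tau> x = resolvent_kernel \<sigma> \<tau> * (p x + 0)" for \<tau> x
  have "(p, v, \<psi>) \<in> wave_domain \<nu> \<and> state_eq \<nu> (shifted_wave_op \<sigma> (p, v, \<psi>))
      (\<lambda>x. s * p x + w * p x, \<lambda>x. s * v x + w * v x, \<lambda>_ _. 0)"
    unfolding \<psi>_def s_def
    by (intro conjI wave_domain_I[OF \<sigma> cont(3) L2_scale[OF L2(4)] p' cont(4) L2_scale[OF L2(3)] v',
          where h = "\<lambda>_ _. 0"])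
       (auto simp: L2_boundary_def memory_flux_def bc sym)
  then have U: "(p, v, \<psi>) \<in> wave_domain \<nu>"
    and F: "state_eq \<nu> (shifted_wave_op \<sigma> (p, v, \<psi>)) (\<lambda>x. (s + w) * p x, \<lambda>x. (s + w) * v x, \<lambda>_ _. 0)"
    by (auto simp: distrib_right)
  have Fe: "(\<lambda>x. (s + w) * p x, \<lambda>x. (s + w) * v x, \<lambda>_ _. 0) \<in> energy_space \<nu>"
    by (auto simp: energy_space_def grad_H1_eq_L2_Omega L2_boundary_def intro!: L2_scale L2)
  define I where "I = (LINT x|Omega. (cmod (p x))\<^sup>2) + (LINT x|Omega. (cmod (v x))\<^sup>2)"
  define N where "N = energy_norm \<nu> (p, v, \<psi>)"
  have "\<psi> \<in> L2_boundary \<nu>" using U by (auto simp: wave_domain_def energy_space_def)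
  then have "N\<^sup>2 = I + (LINT \<tau>|\<nu>. (cmod (\<psi> \<tau> 0))\<^sup>2) + (LINT \<tau>|\<nu>. (cmod (\<psi> \<tau> 1))\<^sup>2)"
    unfolding N_def I_def by (intro energy_norm_square L2)
  then have IN: "I \<le> N\<^sup>2" by simp
  have N: "0 \<le> N" unfolding N_def by (rule energy_norm_nonneg)
  have "1 \<le> I"
  proof -
    \<comment> \<open>The identity \<open>cosh\<^sup>2 - sinh\<^sup>2 = 1\<close> keeps the state away from 0, whatever \<open>w\<close> is.\<close>
    have "1 \<le> (cmod (p x))\<^sup>2 + (cmod (v x))\<^sup>2" for x
    proof -
      have "a x * b x = 1" by (simp add: a_def b_def exp_add[symmetric])
      moreover have "(p x)\<^sup>2 - (v x)\<^sup>2 = a x * b x"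
        by (simp add: p_def v_def power2_eq_square field_simps)
      ultimately have "1 = cmod ((p x)\<^sup>2 - (v x)\<^sup>2)" by simp
      also have "\<dots> \<le> (cmod (p x))\<^sup>2 + (cmod (v x))\<^sup>2"
        using norm_triangle_ineq4[of "(p x)\<^sup>2" "(v x)\<^sup>2"] by (simp add: norm_power)
      finally show ?thesis .
    qed
    then have "(LINT x|Omega. 1) \<le> (LINT x|Omega. (cmod (p x))\<^sup>2 + (cmod (v x))\<^sup>2)"
      using L2(3,4) by (intro integral_mono) (auto simp: L2_def)
    then show ?thesis
      using L2_integrable_square[OF L2(3)] L2_integrable_square[OF L2(4)] by (simp add: I_def)
  qed
  then have N_pos: "0 < N" using IN N by (cases "N = 0") auto
  have F_le: "energy_norm \<nu> (\<lambda>x. (s + w) * p x, \<lambda>x. (s + w) * v x, \<lambda>_ _. 0) \<le> L * N"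
  proof (rule power2_le_imp_le)
    have "(energy_norm \<nu> (\<lambda>x. (s + w) * p x, \<lambda>x. (s + w) * v x, \<lambda>_ _. 0))\<^sup>2 = (cmod (s + w))\<^sup>2 * I"
      unfolding I_def
      by (subst energy_norm_square) (auto simp: L2_boundary_def L2 L2_scale norm_mult power_mult_distrib distrib_left)
    also have "\<dots> \<le> L\<^sup>2 * N\<^sup>2"
      using L IN \<open>1 \<le> I\<close> by (intro mult_mono power_mono) (auto simp: s_def)
    finally show "(energy_norm \<nu> (\<lambda>x. (s + w) * p x, \<lambda>x. (s + w) * v x, \<lambda>_ _. 0))\<^sup>2 \<le> (L * N)\<^sup>2"
      by (simp only: power_mult_distrib)
  qed (use L N in auto)
  show ?thesis
    unfolding resolvent_norm_def
  proof (rule INF_greatest)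
    fix C assume "C \<in> {C. inverse_bound \<nu> \<sigma> C}"
    then have C: "0 \<le> C" "N \<le> C * energy_norm \<nu> (\<lambda>x. (s + w) * p x, \<lambda>x. (s + w) * v x, \<lambda>_ _. 0)"
      using U F Fe unfolding inverse_bound_def N_def by blast+
    have "N \<le> C * (L * N)"
      using C F_le by (meson mult_left_mono order_trans)
    then have "1 \<le> C * L" using N_pos by (simp add: mult.assoc[symmetric])
    then show "ereal (1 / L) \<le> ereal C" using L by (simp add: field_simps)
  qed
qed

lemma Re_reflection_pos:
  fixes k :: complex
  assumes "cmod k < 1"
  shows "0 < Re ((1 - k) / (1 + k))"
proof -
  have "1 + k \<noteq> 0"
    using assms by (metis add_eq_0_iff less_irrefl norm_minus_cancel norm_one)
  moreover have "(cmod k)\<^sup>2 < 1" using assms by (simp add: power_less_one_iff)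
  moreover have "Re ((1 - k) / (1 + k)) = (1 - (cmod k)\<^sup>2) / (cmod (1 + k))\<^sup>2"
    unfolding cmod_power2 by (simp add: Re_divide power2_eq_square algebra_simps)
  ultimately show ?thesis by simp
qed

text \<open>The hypothesis on the imaginary part makes \<open>exp (-i\<sigma>) (1 - k) / (1 + k)\<close> a real number \<open>r\<close>, and \<open>0 \<le> cos \<sigma>\<close>
  makes it positive. So \<open>w = - ln r - i\<sigma>\<close> is a solution, and \<open>r\<^sup>2 = 1 - 4 Re k / \<bar>1 + k\<bar>\<^sup>2\<close> is close to 1.\<close>

lemma quasimode_exponent:
  fixes k :: complex and \<sigma> :: real
  assumes k: "cmod k \<le> 1 / 8" "0 < Re k"
    and real: "Im (exp (- (\<i> * complex_of_real \<sigma>)) * ((1 - k) / (1 + k))) = 0"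
    and pos: "0 \<le> cos \<sigma>"
  shows "\<exists>w. exp w * (1 - k) = 1 + k \<and> cmod (\<i> * complex_of_real \<sigma> + w) \<le> 4 * Re k"
proof -
  define \<rho> where "\<rho> = (1 - k) / (1 + k)"
  define r where "r = Re (exp (- (\<i> * complex_of_real \<sigma>)) * \<rho>)"
  have nz: "1 + k \<noteq> 0" using k(2) by (auto simp: complex_eq_iff)
  have er: "exp (- (\<i> * complex_of_real \<sigma>)) * \<rho> = complex_of_real r"
    using real by (simp add: r_def \<rho>_def complex_eq_iff)
  have \<rho>_eq: "\<rho> = complex_of_real r * exp (\<i> * complex_of_real \<sigma>)"
    using er by (simp add: exp_minus field_simps)
  have abs_r: "\<bar>r\<bar> = cmod \<rho>"
    unfolding \<rho>_eq by (simp add: norm_mult)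
  have Re_\<rho>: "0 < Re \<rho>"
    unfolding \<rho>_def using k by (intro Re_reflection_pos) auto
  have "Re \<rho> = r * cos \<sigma>" unfolding \<rho>_eq by (simp add: Re_exp)
  with Re_\<rho> pos have r_pos: "0 < r"
    by (metis less_eq_real_def linorder_not_less mult_nonneg_nonneg mult_pos_pos zero_less_mult_iff)
  define x where "x = 4 * Re k / (cmod (1 + k))\<^sup>2"
  have n1: "1 \<le> (cmod (1 + k))\<^sup>2"
  proof -
    have "1 \<le> cmod (1 + k)" using complex_Re_le_cmod[of "1 + k"] k(2) by simp
    then show ?thesis by simp
  qed
  have "x \<le> 4 * Re k" using n1 k(2) by (simp add: x_def divide_le_eq)
  have x: "0 < x" using k(2) nz by (simp add: x_def)
  have "Re k \<le> 1 / 8" using k(1) complex_Re_le_cmod[of k] by simp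
  then have x2: "x \<le> 1 / 2" using \<open>x \<le> 4 * Re k\<close> by simp
  have r2: "r\<^sup>2 = 1 - x"
  proof -
    have "r\<^sup>2 = (cmod \<rho>)\<^sup>2" unfolding abs_r[symmetric] by simp
    also have "\<dots> = (cmod (1 - k))\<^sup>2 / (cmod (1 + k))\<^sup>2" by (simp add: \<rho>_def norm_divide power_divide)
    also have "(cmod (1 - k))\<^sup>2 = (cmod (1 + k))\<^sup>2 - 4 * Re k"
      unfolding cmod_power2 by (simp add: power2_eq_square algebra_simps)
    finally show ?thesis using nz by (simp add: x_def diff_divide_distrib)
  qed
  define w where "w = complex_of_real (- ln r) - \<i> * complex_of_real \<sigma>"
  have "exp w * \<rho> = exp (complex_of_real (- ln r)) * (exp (- (\<i> * complex_of_real \<sigma>)) * \<rho>)"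
    by (simp add: w_def exp_diff exp_minus field_simps)
  also have "\<dots> = complex_of_real (exp (- ln r) * r)"
    unfolding er by (simp only: of_real_exp of_real_mult)
  also have "exp (- ln r) * r = 1" using r_pos by (simp add: exp_minus)
  finally have "exp w * (1 - k) = 1 + k" using nz by (simp add: \<rho>_def field_simps)
  moreover have "cmod (\<i> * complex_of_real \<sigma> + w) \<le> 4 * Re k"
  proof -
    have "r \<le> 1" using r2 x power2_le_imp_le[of r 1] by simp
    then have "ln r \<le> 0" using r_pos by simp
    have "2 * (- ln r) = ln (inverse (r\<^sup>2))" using r_pos by (simp add: ln_inverse ln_realpow)
    also have "\<dots> \<le> inverse (r\<^sup>2) - 1" using r_pos by (intro ln_le_minus_one) simp
    also have "\<dots> \<le> 2 * x" using x x2 unfolding r2 by (simp add: field_simps)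
    finally have "- ln r \<le> x" by simp
    then show ?thesis
      using \<open>x \<le> 4 * Re k\<close> \<open>ln r \<le> 0\<close> by (simp add: w_def)
  qed
  ultimately show ?thesis by blast
qed

text \<open>The phase of \<open>(1 - \<kappa>) / (1 + \<kappa>)\<close> stays between \<open>-\<pi>/2\<close> and \<open>\<pi>/2\<close> when \<open>\<bar>\<kappa>\<bar> < 1\<close>. Hence the imaginary part of its
  product with \<open>exp (-i\<sigma>)\<close> changes sign on each interval of radius \<open>\<pi>/2\<close> around a multiple of \<open>2\<pi>\<close>.\<close>

lemma resolvent_norm_ge_high_frequency:
  "\<exists>s0>1. \<forall>s\<ge>s0. \<exists>\<sigma>. 1 \<le> \<sigma> \<and> \<sigma> \<le> s \<and> ereal (1 / (16 * Re (\<kappa> s))) \<le> resolvent_norm \<nu> \<sigma>"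
proof -
  have "\<forall>\<^sub>F \<sigma> in at_top. cmod (\<kappa> \<sigma>) < 1 / 8"
    using tendsto_norm[OF khat_tendsto_0] by (rule order_tendstoD) simp
  then obtain \<sigma>0 where \<sigma>0: "\<And>\<sigma>. \<sigma>0 \<le> \<sigma> \<Longrightarrow> cmod (\<kappa> \<sigma>) < 1 / 8"
    unfolding eventually_at_top_linorder by blast
  \<comment> \<open>Large enough that the resonance chosen below \<open>s\<close> is at least \<open>s/2\<close>, \<open>\<sigma>0\<close> and 1.\<close>
  define s0 where "s0 = 2 * max \<sigma>0 (6 * pi)"
  have "1 < s0" using pi_gt3 by (auto simp: s0_def less_max_iff_disj)
  moreover have "\<exists>\<sigma>. 1 \<le> \<sigma> \<and> \<sigma> \<le> s \<and> ereal (1 / (16 * Re (\<kappa> s))) \<le> resolvent_norm \<nu> \<sigma>" if s: "s0 \<le> s" for s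
  proof -
    have s': "2 * \<sigma>0 \<le> s" "12 * pi \<le> s" using s by (auto simp: s0_def max_def split: if_splits)
    \<comment> \<open>\<open>T\<close> is the last multiple of \<open>2\<pi>\<close> whose interval of radius \<open>\<pi>/2\<close> lies below \<open>s\<close>.\<close>
    define n where "n = \<lfloor>(s - pi / 2) / (2 * pi)\<rfloor>"
    define T where "T = 2 * pi * of_int n"
    have "of_int n \<le> (s - pi / 2) / (2 * pi)" "(s - pi / 2) / (2 * pi) < of_int n + 1"
      unfolding n_def by linarith+
    then have T: "T + pi / 2 \<le> s" "s < T + 5 * pi / 2"
      using pi_gt_zero by (simp_all add: T_def field_simps)
    have range: "s / 2 \<le> \<sigma>" "\<sigma>0 \<le> \<sigma>" "1 \<le> \<sigma>" "\<sigma> \<le> s" if "T - pi / 2 \<le> \<sigma>" "\<sigma> \<le> T + pi / 2" for \<sigma>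
      using that T s' pi_gt3 by linarith+
    define \<rho> where "\<rho> \<sigma> = (1 - \<kappa> \<sigma>) / (1 + \<kappa> \<sigma>)" for \<sigma>
    have nz: "1 + \<kappa> \<sigma> \<noteq> 0" for \<sigma>
      using Re_khat_pos[of \<sigma>] by (auto simp: complex_eq_iff)
    define \<Phi> where "\<Phi> \<sigma> = Im (exp (- (\<i> * complex_of_real \<sigma>)) * \<rho> \<sigma>)" for \<sigma>
    have cont: "continuous_on A \<Phi>" for A
      unfolding \<Phi>_def \<rho>_def by (intro continuous_intros continuous_khat nz ballI)
    have Re_\<rho>: "0 < Re (\<rho> \<sigma>)" if "\<sigma>0 \<le> \<sigma>" for \<sigma>
      unfolding \<rho>_def using \<sigma>0[OF that] by (intro Re_reflection_pos) simp
    have cs: "cos T = 1" "sin T = 0"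
      by (simp_all add: T_def cos_int_2pin sin_int_2pin)
    have trig: "cos (T - pi / 2) = 0" "sin (T - pi / 2) = - 1" "cos (T + pi / 2) = 0" "sin (T + pi / 2) = 1"
      by (simp_all add: cos_diff sin_diff cos_add sin_add cs)
    have \<Phi>_eq: "\<Phi> \<sigma> = cos \<sigma> * Im (\<rho> \<sigma>) - sin \<sigma> * Re (\<rho> \<sigma>)" for \<sigma>
      by (simp add: \<Phi>_def Re_exp Im_exp)
    have "\<exists>\<sigma>\<ge>T - pi / 2. \<sigma> \<le> T + pi / 2 \<and> \<Phi> \<sigma> = 0"
    proof (rule IVT2')
      show "\<Phi> (T + pi / 2) \<le> 0" "0 \<le> \<Phi> (T - pi / 2)"
        unfolding \<Phi>_eq trig using Re_\<rho>[of "T + pi / 2"] Re_\<rho>[of "T - pi / 2"] range by (auto simp: less_imp_le)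
    qed (use cont in auto)
    then obtain \<sigma> where \<sigma>: "T - pi / 2 \<le> \<sigma>" "\<sigma> \<le> T + pi / 2" "\<Phi> \<sigma> = 0" by blast
    note range = range[OF \<sigma>(1,2)]
    have "cos \<sigma> = cos (\<sigma> - T)" by (simp add: cos_diff cs)
    moreover have "0 \<le> cos (\<sigma> - T)" using \<sigma> by (intro cos_ge_zero) auto
    ultimately have "0 \<le> cos \<sigma>" by simp
    then obtain w where w: "exp w * (1 - \<kappa> \<sigma>) = 1 + \<kappa> \<sigma>" "cmod (\<i> * complex_of_real \<sigma> + w) \<le> 4 * Re (\<kappa> \<sigma>)"
      using quasimode_exponent[of "\<kappa> \<sigma>" \<sigma>] \<sigma>0[OF range(2)] Re_khat_pos[of \<sigma>] \<sigma>(3)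
      by (auto simp: \<Phi>_def \<rho>_def)
    have "Re (\<kappa> \<sigma>) \<le> 4 * Re (\<kappa> s)"
      using range by (intro Re_khat_doubling) auto
    with w(2) have "cmod (\<i> * complex_of_real \<sigma> + w) \<le> 16 * Re (\<kappa> s)" by linarith
    from resolvent_norm_ge[OF _ w(1) this] show ?thesis
      using range Re_khat_pos[of s] by (intro exI[of _ \<sigma>]) auto
  qed
  ultimately show ?thesis by blast
qed

text \<open>Covers the bounded range of frequencies below the first usable resonance.\<close>

lemma resolvent_norm_1_pos:
  "\<exists>c>0. ereal c \<le> resolvent_norm \<nu> 1"
proof -
  have nz: "1 + \<kappa> 1 \<noteq> 0" using Re_khat_pos[of 1] by (auto simp: complex_eq_iff)
  have nz': "1 - \<kappa> 1 \<noteq> 0" using Im_khat_neg[of 1] by (auto simp: complex_eq_iff)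
  define w where "w = Ln ((1 + \<kappa> 1) / (1 - \<kappa> 1))"
  have "exp w * (1 - \<kappa> 1) = 1 + \<kappa> 1" using nz nz' by (simp add: w_def)
  from resolvent_norm_ge[OF _ this, of "cmod (\<i> * complex_of_real 1 + w) + 1"]
  have "ereal (1 / (cmod (\<i> * complex_of_real 1 + w) + 1)) \<le> resolvent_norm \<nu> 1"
    using norm_ge_zero[of "\<i> * complex_of_real 1 + w"] by (simp add: add_nonneg_pos)
  then show ?thesis
    by (rule_tac exI[of _ "1 / (cmod (\<i> * complex_of_real 1 + w) + 1)"]) (auto intro!: divide_pos_pos add_nonneg_pos)
qed

end

section \<open>Two-sided resolvent bound\<close>

theorem theorem20:
  fixes k :: "real \<Rightarrow> real" and \<nu> :: "real measure"
  assumes borel: "sets \<nu> = sets borel"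
    and radon: "\<And>K. compact K \<Longrightarrow> emeasure \<nu> K < \<infinity>"
    and carrier: "emeasure \<nu> {..<0} = 0"
    and laplace: "\<And>t. 0 < t \<Longrightarrow> integrable \<nu> (\<lambda>\<tau>. exp (- \<tau> * t))"
      "\<And>t. 0 < t \<Longrightarrow> k t = (LINT \<tau>|\<nu>. exp (- \<tau> * t))"
    and k_integrable: "set_integrable lborel {0<..} k"
    and k_nonzero: "\<exists>t>0. k t \<noteq> 0"
  shows "\<exists>c C::real. 0 < c \<and> 0 < C \<and>
    (\<forall>s::real. 1 < s \<longrightarrow>
       ereal (c / Re (khat \<nu> (\<i> * complex_of_real s)))
         \<le> (SUP \<sigma> \<in> {\<sigma>::real. 1 \<le> \<bar>\<sigma>\<bar> \<and> \<bar>\<sigma>\<bar> \<le> s}. resolvent_norm \<nu> \<sigma>) \<and>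
       (SUP \<sigma> \<in> {\<sigma>::real. 1 \<le> \<bar>\<sigma>\<bar> \<and> \<bar>\<sigma>\<bar> \<le> s}. resolvent_norm \<nu> \<sigma>)
         \<le> ereal (C / Re (khat \<nu> (\<i> * complex_of_real s))))"
proof -
  interpret relaxation_measure \<nu>
    by (rule relaxation_measure_of_integrable_kernel[OF borel radon carrier laplace k_integrable k_nonzero])
  obtain s0 where s0: "1 < s0" and high: "\<And>s. s0 \<le> s \<Longrightarrow>
      \<exists>\<sigma>. 1 \<le> \<sigma> \<and> \<sigma> \<le> s \<and> ereal (1 / (16 * Re (\<kappa> s))) \<le> resolvent_norm \<nu> \<sigma>"
    using resolvent_norm_ge_high_frequency by blast
  obtain c1 where c1: "0 < c1" "ereal c1 \<le> resolvent_norm \<nu> 1"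
    using resolvent_norm_1_pos by blast
  define c where "c = min (1 / 16) (c1 * Re (\<kappa> s0))"
  have c: "0 < c" using c1 Re_khat_pos by (simp add: c_def)
  have C: "0 < resolvent_constant" using K_nonneg by (simp add: resolvent_constant_def)
  have lower: "ereal (c / Re (\<kappa> s)) \<le> (SUP \<sigma> \<in> {\<sigma>. 1 \<le> \<bar>\<sigma>\<bar> \<and> \<bar>\<sigma>\<bar> \<le> s}. resolvent_norm \<nu> \<sigma>)"
    if s: "1 < s" for s
  proof -
    have "\<exists>\<sigma>. 1 \<le> \<sigma> \<and> \<sigma> \<le> s \<and> ereal (c / Re (\<kappa> s)) \<le> resolvent_norm \<nu> \<sigma>"
    proof (cases "s0 \<le> s")
      case True
      then obtain \<sigma> where \<sigma>: "1 \<le> \<sigma>" "\<sigma> \<le> s" "ereal (1 / (16 * Re (\<kappa> s))) \<le> resolvent_norm \<nu> \<sigma>"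
        using high by blast
      have "c / Re (\<kappa> s) \<le> (1 / 16) / Re (\<kappa> s)"
        using Re_khat_pos[of s] by (intro divide_right_mono) (auto simp: c_def)
      then have "ereal (c / Re (\<kappa> s)) \<le> ereal (1 / (16 * Re (\<kappa> s)))" by simp
      with \<sigma> show ?thesis by (meson order_trans)
    next
      case False
      then have "Re (\<kappa> s0) \<le> Re (\<kappa> s)"
        using s by (intro Re_khat_antimono) auto
      then have "c \<le> c1 * Re (\<kappa> s)"
        using c1 by (auto simp: c_def min_le_iff_disj intro!: disjI2 mult_left_mono)
      then have "ereal (c / Re (\<kappa> s)) \<le> ereal c1"
        using Re_khat_pos[of s] by (simp add: divide_le_eq)
      from order_trans[OF this c1(2)] show ?thesis using s by (intro exI[of _ 1]) auto
    qed
    then obtain \<sigma> where \<sigma>: "1 \<le> \<sigma>" "\<sigma> \<le> s" "ereal (c / Re (\<kappa> s)) \<le> resolvent_norm \<nu> \<sigma>" by blast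
    then show ?thesis by (intro SUP_upper2[of \<sigma>]) auto
  qed
  have upper: "(SUP \<sigma> \<in> {\<sigma>. 1 \<le> \<bar>\<sigma>\<bar> \<and> \<bar>\<sigma>\<bar> \<le> s}. resolvent_norm \<nu> \<sigma>) \<le> ereal (resolvent_constant / Re (\<kappa> s))"
    for s
  proof (rule SUP_least)
    fix \<sigma> :: real assume "\<sigma> \<in> {\<sigma>. 1 \<le> \<bar>\<sigma>\<bar> \<and> \<bar>\<sigma>\<bar> \<le> s}"
    then have \<sigma>: "1 \<le> \<bar>\<sigma>\<bar>" "\<bar>\<sigma>\<bar> \<le> s" by auto
    have "Re (\<kappa> s) \<le> Re (\<kappa> \<sigma>)" using \<sigma> by (intro Re_khat_antimono) auto
    then have "resolvent_constant / Re (\<kappa> \<sigma>) \<le> resolvent_constant / Re (\<kappa> s)"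
      using Re_khat_pos C by (intro divide_left_mono) (auto intro!: mult_pos_pos)
    with resolvent_norm_le[OF \<sigma>(1)] show "resolvent_norm \<nu> \<sigma> \<le> ereal (resolvent_constant / Re (\<kappa> s))"
      by (meson ereal_less_eq(3) order_trans)
  qed
  show ?thesis using c C lower upper by blast
qed

end
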